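(* Let $X=\{X_t,\ t\ge 0\}$ be a real-valued process with $X_0=0$, independent increments, continuous in probability, with càdlàg paths, such that $\mathbb{E}[X_t]=0$ and $\mathbb{E}[|X_t|^k]<\infty$ for all $t\ge 0$ and all $k\ge 1$. For $t\ge 0$ let $\sigma_t^2$ be the variance of the Gaussian part of the infinitely divisible law of $X_t$ and $\nu_t$ its Lévy measure, and set $$F_2(t)=\sigma_t^2+\int_{\mathbb{R}\setminus\{0\}}x^2\,\nu_t(dx),\qquad F_n(t)=\int_{\mathbb{R}\setminus\{0\}}x^n\,\nu_t(dx),\ n\ge 3.$$ Then for every $n\ge 1$ the process $$M^{(n)}_t=\Gamma_n\big(X_t,-F_2(t),\dots,-F_n(t)\big),\qquad t\ge 0,$$ is a martingale with respect to the natural filtration of $X$.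
   Context: The Kendall polynomials $\Gamma_n(x_1,\dots,x_n)$, $n\ge 1$, are the polynomials expressing moments in terms of cumulants: they are defined by the formal power series identity $$\exp\Big\{\sum_{n=1}^\infty \kappa_n\frac{u^n}{n!}\Big\}=\sum_{n=0}^\infty \Gamma_n(\kappa_1,\dots,\kappa_n)\frac{u^n}{n!},$$ with $\Gamma_0=1$ (so e.g. $\Gamma_1(x_1)=x_1$, $\Gamma_2(x_1,x_2)=x_1^2+x_2$, $\Gamma_3(x_1,x_2,x_3)=x_1^3+3x_1x_2+x_3$). Under the hypotheses, $\int_{|x|>1}|x|\,\nu_t(dx)<\infty$ and $\int|x|^n\nu_t(dx)<\infty$ for all $n\ge2$, and $F_n(t)$ is the $n$-th cumulant of $X_t$ for $n\ge 2$. *)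

theory Defs
  imports "HOL-Probability.Probability" "HOL-Computational_Algebra.Formal_Power_Series"
begin

text \<open>Kendall polynomials: exp(sum_{n>=1} kappa_n u^n/n!) = sum_n Gamma_n(kappa) u^n/n!.
  Gamma_n only depends on kappa 1, ..., kappa n.\<close>
definition kendall :: "nat \<Rightarrow> (nat \<Rightarrow> real) \<Rightarrow> real" where
  "kendall n \<kappa> = fact n *
     fps_nth ((fps_exp (1::real)) oo (Abs_fps (\<lambda>k. if k = 0 then 0 else \<kappa> k / fact k))) n"

definition levy_khintchine :: "real measure \<Rightarrow> real \<Rightarrow> real measure \<Rightarrow> bool" where
  "levy_khintchine \<mu> \<sigma>2 \<nu> \<longleftrightarrow>
     \<sigma>2 \<ge> 0 \<and> sets \<nu> = sets borel \<and> emeasure \<nu> {0} = 0 \<and>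
     integrable \<nu> (\<lambda>x. min 1 (x\<^sup>2)) \<and>
     (\<exists>b::real. \<forall>u::real. char \<mu> u =
        exp (\<i> * complex_of_real (b * u) - complex_of_real (\<sigma>2 * u\<^sup>2 / 2)
             + (CLINT x|\<nu>. iexp (u * x) - 1 - \<i> * complex_of_real (u * x * indicator {-1..1} x))))"

definition natural_filtration :: "'a measure \<Rightarrow> (real \<Rightarrow> 'a \<Rightarrow> real) \<Rightarrow> real \<Rightarrow> 'a measure" where
  "natural_filtration M X t =
     sigma (space M) (\<Union>s\<in>{0..t}. {X s -` A \<inter> space M | A. A \<in> sets borel})"

definition martingale_wrt :: "'a measure \<Rightarrow> (real \<Rightarrow> 'a measure) \<Rightarrow> (real \<Rightarrow> 'a \<Rightarrow> real) \<Rightarrow> bool" where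
  "martingale_wrt M F Y \<longleftrightarrow>
     (\<forall>t\<ge>0. integrable M (Y t) \<and> Y t \<in> borel_measurable (F t)) \<and>
     (\<forall>s t A. 0 \<le> s \<longrightarrow> s \<le> t \<longrightarrow> A \<in> sets (F s) \<longrightarrow>
        (LINT \<omega>:A|M. Y t \<omega>) = (LINT \<omega>:A|M. Y s \<omega>))"

end

theory Submission
  imports Defs
begin

text \<open>Write \<open>m\<^sub>t(u) = \<Sum> E[X\<^sub>t^n] u^n / n!\<close> as a formal power series. Once \<open>m\<^sub>t\<close> is known to be the formal
  exponential of \<open>\<Sum> F\<^sub>k(t) u^k / k!\<close> (sum over \<open>k \<ge> 2\<close>), the variable \<open>M\<^sub>t\<close> is \<open>n!\<close> times the
  coefficient of \<open>u^n\<close> in \<open>exp(u X\<^sub>t) / m\<^sub>t(u)\<close>. For \<open>s < t\<close> the increment \<open>D = X\<^sub>t - X\<^sub>s\<close> is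
  independent of the past, so \<open>m\<^sub>t\<close> is \<open>m\<^sub>s\<close> times the moment series of \<open>D\<close>, and the latter cancels
  when \<open>exp(u X\<^sub>t) = exp(u X\<^sub>s) exp(u D)\<close> is integrated over an event of the past.

  That the \<open>F\<^sub>k\<close> are the cumulants follows by comparing asymptotic expansions at 0 of the two sides of
  the Levy-Khintchine formula. This requires the moments of the Levy measure to be finite: by the
  formula, \<open>\<integral> (cos(u x) - 1) d\<nu>\<close> equals the logarithm of the modulus of the characteristic function up
  to a quadratic term, so it has an asymptotic expansion to all orders, and its even-order central
  differences bound the even moments of \<open>\<nu>\<close>.\<close>

section \<open>Asymptotic expansions at 0\<close>

text \<open>No convergence is asked for, as the characteristic functions below need not be analytic.
  Coefficients form a formal power series so that operations on functions become formal ones. The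
  filter is \<open>nhds 0\<close>, not \<open>at 0\<close>: thus \<open>f 0\<close> equals the
  constant coefficient, and composition also works where the inner function vanishes.\<close>

definition asym_expansion :: "(real \<Rightarrow> 'a::real_normed_field) \<Rightarrow> 'a fps \<Rightarrow> bool" where
  "asym_expansion f A \<longleftrightarrow>
     (\<forall>N. (\<lambda>u. f u - (\<Sum>j<N. fps_nth A j * of_real u ^ j)) \<in> O[nhds 0](\<lambda>u. of_real u ^ N))"

lemma asym_expansionD:
  "asym_expansion f A \<Longrightarrow>
     (\<lambda>u. f u - (\<Sum>j<N. fps_nth A j * of_real u ^ j)) \<in> O[nhds 0](\<lambda>u. of_real u ^ N)"
  by (simp add: asym_expansion_def)

lemma of_real_power_bigo_mono:
  assumes "N \<le> k"
  shows "(\<lambda>u::real. (of_real u :: 'a::real_normed_field) ^ k) \<in> O[nhds 0](\<lambda>u. of_real u ^ N)"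
proof (rule bigoI[where c = 1])
  have "eventually (\<lambda>u::real. \<bar>u\<bar> < 1) (nhds 0)"
    using eventually_nhds_metric[of "\<lambda>u::real. \<bar>u\<bar> < 1" 0] by (auto intro!: exI[of _ 1])
  then show "\<forall>\<^sub>F u in nhds 0. norm ((of_real u :: 'a) ^ k) \<le> 1 * norm ((of_real u :: 'a) ^ N)"
    by eventually_elim (use assms in \<open>auto simp: norm_power intro!: power_decreasing\<close>)
qed

lemma asym_expansion_bigo_1:
  assumes "asym_expansion f A"
  shows "f \<in> O[nhds 0](\<lambda>_. 1)"
  using asym_expansionD[OF assms, of 0] by simp

section \<open>Algebra of asymptotic expansions\<close>

lemma asym_expansion_const: "asym_expansion (\<lambda>_. c) (fps_const c)"
  unfolding asym_expansion_def
proof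
  fix N
  show "(\<lambda>u. c - (\<Sum>j<N. fps_nth (fps_const c) j * of_real u ^ j)) \<in> O[nhds 0](\<lambda>u. of_real u ^ N)"
  proof (cases N)
    case (Suc k)
    then have "(\<Sum>j<N. fps_nth (fps_const c) j * of_real u ^ j) = c" for u
      by (subst sum.mono_neutral_right[of _ "{0}"]) auto
    then show ?thesis by simp
  qed simp
qed

lemma asym_expansion_add:
  assumes "asym_expansion f A" "asym_expansion g B"
  shows "asym_expansion (\<lambda>u. f u + g u) (A + B)"
  unfolding asym_expansion_def
proof
  fix N
  have "(\<lambda>u. (f u - (\<Sum>j<N. fps_nth A j * of_real u ^ j)) + (g u - (\<Sum>j<N. fps_nth B j * of_real u ^ j)))
          \<in> O[nhds 0](\<lambda>u. of_real u ^ N)"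
    by (intro sum_in_bigo asym_expansionD assms)
  then show "(\<lambda>u. f u + g u - (\<Sum>j<N. fps_nth (A + B) j * of_real u ^ j))
          \<in> O[nhds 0](\<lambda>u. of_real u ^ N)"
    by (simp add: sum.distrib algebra_simps)
qed

lemma asym_expansion_sum:
  assumes "\<And>i. i \<in> I \<Longrightarrow> asym_expansion (f i) (A i)"
  shows "asym_expansion (\<lambda>u. \<Sum>i\<in>I. f i u) (\<Sum>i\<in>I. A i)"
  using assms
proof (induction I rule: infinite_finite_induct)
  case (insert i I)
  then show ?case by (simp add: asym_expansion_add)
qed (use asym_expansion_const[of 0] in simp_all)

text \<open>With \<open>P\<close> and \<open>Q\<close> the truncations at order \<open>N\<close>,
  \<open>f g - P Q = (f - P) g + P (g - Q)\<close> is O(u^N). In \<open>P Q\<close>, the products of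
  total degree below \<open>N\<close> make up the truncated Cauchy product; the others, indexed by
  \<open>S\<close>, are O(u^N).\<close>

lemma asym_expansion_mult:
  fixes f g :: "real \<Rightarrow> 'a::real_normed_field"
  assumes f: "asym_expansion f A" and g: "asym_expansion g B"
  shows "asym_expansion (\<lambda>u. f u * g u) (A * B)"
  unfolding asym_expansion_def
proof
  fix N
  let ?O = "O[nhds 0](\<lambda>u::real. (of_real u :: 'a) ^ N)"
  define P Q where "P u = (\<Sum>j<N. fps_nth A j * of_real u ^ j)"
    and "Q u = (\<Sum>j<N. fps_nth B j * of_real u ^ j)" for u :: real
  define S where "S = {(i, j). i < N \<and> j < N \<and> N \<le> i + j}"
  have fin: "finite S" by (rule finite_subset[of _ "{..<N} \<times> {..<N}"]) (auto simp: S_def)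
  have fP: "(\<lambda>u. f u - P u) \<in> ?O" and gQ: "(\<lambda>u. g u - Q u) \<in> ?O"
    using asym_expansionD[OF f, of N] asym_expansionD[OF g, of N] by (simp_all add: P_def Q_def)
  have "P \<in> O[nhds 0](\<lambda>_. 1)"
  proof -
    have "(\<lambda>u. f u - (f u - P u)) \<in> O[nhds 0](\<lambda>_. 1)"
      using of_real_power_bigo_mono[of 0 N]
      by (intro sum_in_bigo asym_expansion_bigo_1[OF f] landau_o.big.trans[OF fP]) simp
    then show ?thesis by simp
  qed
  then have "(\<lambda>u. P u * (g u - Q u)) \<in> O[nhds 0](\<lambda>u. 1 * of_real u ^ N)"
    using gQ by (rule landau_o.big.mult)
  moreover have "(\<lambda>u. (f u - P u) * g u) \<in> O[nhds 0](\<lambda>u. of_real u ^ N * 1)"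
    using fP asym_expansion_bigo_1[OF g] by (rule landau_o.big.mult)
  moreover have "(\<lambda>u. \<Sum>(i,j)\<in>S. (fps_nth A i * fps_nth B j) * of_real u ^ (i + j)) \<in> ?O"
    unfolding case_prod_unfold
  proof (rule big_sum_in_bigo)
    fix p assume "p \<in> S"
    then show "(\<lambda>u. fps_nth A (fst p) * fps_nth B (snd p) * of_real u ^ (fst p + snd p)) \<in> ?O"
      using of_real_power_bigo_mono[of N "fst p + snd p", where 'a = 'a]
      by (cases "fps_nth A (fst p) * fps_nth B (snd p) = 0") (auto simp: S_def)
  qed
  ultimately have "(\<lambda>u. (f u - P u) * g u + P u * (g u - Q u)
      + (\<Sum>(i,j)\<in>S. (fps_nth A i * fps_nth B j) * of_real u ^ (i + j))) \<in> ?O"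
    by (intro sum_in_bigo) simp_all
  moreover have "(f u - P u) * g u + P u * (g u - Q u)
      + (\<Sum>(i,j)\<in>S. (fps_nth A i * fps_nth B j) * of_real u ^ (i + j))
      = f u * g u - (\<Sum>j<N. fps_nth (A * B) j * of_real u ^ j)" for u
  proof -
    let ?t = "\<lambda>(i,j). (fps_nth A i * fps_nth B j) * (of_real u :: 'a) ^ (i + j)"
    have "P u * Q u = (\<Sum>p\<in>{..<N} \<times> {..<N}. ?t p)"
      unfolding P_def Q_def sum_product sum.cartesian_product
      by (intro sum.cong) (auto simp: power_add)
    also have "{..<N} \<times> {..<N} = S \<union> {(i, j). i + j < N}"
      by (auto simp: S_def)
    also have "sum ?t (S \<union> {(i, j). i + j < N}) = sum ?t S + sum ?t {(i, j). i + j < N}"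
    proof (rule sum.union_disjoint)
      show "finite {(i, j). i + j < N}"
        by (rule finite_subset[of _ "{..<N} \<times> {..<N}"]) auto
    qed (use fin in \<open>auto simp: S_def\<close>)
    also have "sum ?t {(i, j). i + j < N} = (\<Sum>k<N. \<Sum>i\<le>k. ?t (i, k - i))"
      using sum.triangle_reindex[of "\<lambda>i j. ?t (i, j)" N] by (simp add: case_prod_unfold)
    also have "\<dots> = (\<Sum>j<N. fps_nth (A * B) j * of_real u ^ j)"
      by (intro sum.cong) (auto simp: fps_mult_nth sum_distrib_right atLeast0AtMost intro!: sum.cong)
    finally show ?thesis by (simp add: algebra_simps)
  qed
  ultimately show "(\<lambda>u. f u * g u - (\<Sum>j<N. fps_nth (A * B) j * of_real u ^ j)) \<in> ?O"
    by simp
qed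

lemma asym_expansion_cmult:
  assumes "asym_expansion f A"
  shows "asym_expansion (\<lambda>u. c * f u) (fps_const c * A)"
  using asym_expansion_mult[OF asym_expansion_const assms] .

lemma asym_expansion_power:
  assumes "asym_expansion f A"
  shows "asym_expansion (\<lambda>u. f u ^ n) (A ^ n)"
proof (induction n)
  case 0
  then show ?case using asym_expansion_const[of 1] by simp
next
  case (Suc n)
  then show ?case using asym_expansion_mult[OF assms] by simp
qed

lemma asym_expansion_of_real: "asym_expansion (of_real :: real \<Rightarrow> 'a::real_normed_field) fps_X"
  unfolding asym_expansion_def
proof
  fix N
  show "(\<lambda>u. (of_real u :: 'a) - (\<Sum>j<N. fps_nth fps_X j * of_real u ^ j)) \<in> O[nhds 0](\<lambda>u. of_real u ^ N)"
  proof (cases "N \<le> 1")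
    case True
    then have "(\<Sum>j<N. fps_nth fps_X j * of_real u ^ j) = (0::'a)" for u
      by (intro sum.neutral) auto
    then show ?thesis
      using of_real_power_bigo_mono[OF True, where 'a = 'a] by (simp del: fps_X_nth)
  next
    case False
    then have "(\<Sum>j<N. fps_nth fps_X j * of_real u ^ j) = (of_real u :: 'a)" for u
      by (subst sum.mono_neutral_right[of _ "{1}"]) auto
    then show ?thesis by (simp del: fps_X_nth)
  qed
qed

lemma asym_expansion_scale:
  fixes f :: "real \<Rightarrow> 'a::real_normed_field"
  assumes "asym_expansion f A"
  shows "asym_expansion (\<lambda>u. f (c * u)) (Abs_fps (\<lambda>n. of_real c ^ n * fps_nth A n))"
  unfolding asym_expansion_def
proof
  fix N
  have "filterlim (\<lambda>u::real. c * u) (nhds 0) (nhds 0)"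
    by (rule tendsto_eq_intros filterlim_ident refl | simp)+
  from landau_o.big.compose[OF asym_expansionD[OF assms, of N] this]
  have "(\<lambda>u. f (c * u) - (\<Sum>j<N. fps_nth A j * of_real (c * u) ^ j))
         \<in> O[nhds 0](\<lambda>u. of_real c ^ N * of_real u ^ N)"
    by (simp add: power_mult_distrib)
  also have "(\<lambda>u. of_real c ^ N * (of_real u :: 'a) ^ N) \<in> O[nhds 0](\<lambda>u::real. of_real u ^ N)"
    by simp
  finally show "(\<lambda>u. f (c * u) - (\<Sum>j<N. fps_nth (Abs_fps (\<lambda>n. of_real c ^ n * fps_nth A n)) j * of_real u ^ j))
       \<in> O[nhds 0](\<lambda>u. of_real u ^ N)"
    by (simp add: power_mult_distrib mult_ac)
qed

text \<open>Serves to pass from a complex-valued function to its real and imaginary parts,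
  \<open>L\<close> being \<open>Re\<close> or \<open>Im\<close>.\<close>

lemma asym_expansion_bounded_linear:
  fixes f :: "real \<Rightarrow> 'a::real_normed_field" and L :: "'a \<Rightarrow> 'b::real_normed_field"
  assumes f: "asym_expansion f A" and L: "bounded_linear L"
  shows "asym_expansion (\<lambda>u. L (f u)) (Abs_fps (\<lambda>n. L (fps_nth A n)))"
  unfolding asym_expansion_def
proof
  interpret bounded_linear L by (rule L)
  fix N
  obtain K where K: "\<And>x. norm (L x) \<le> norm x * K" using bounded by blast
  let ?g = "\<lambda>u. f u - (\<Sum>j<N. fps_nth A j * of_real u ^ j)"
  obtain C where C: "\<forall>\<^sub>F u in nhds 0. norm (?g u) \<le> C * norm ((of_real u :: 'a) ^ N)"
    using asym_expansionD[OF f, of N] by (auto elim!: landau_o.bigE)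
  have "(\<lambda>u. L (?g u)) \<in> O[nhds 0](\<lambda>u. of_real u ^ N)"
  proof (rule bigoI[where c = "C * \<bar>K\<bar>"])
    show "\<forall>\<^sub>F u in nhds 0. norm (L (?g u)) \<le> C * \<bar>K\<bar> * norm ((of_real u :: 'b) ^ N)"
      using C
    proof eventually_elim
      case (elim u)
      have "norm (L (?g u)) \<le> norm (?g u) * \<bar>K\<bar>"
        using K[of "?g u"] by (smt (verit) mult_left_mono norm_ge_zero)
      also have "\<dots> \<le> (C * norm ((of_real u :: 'a) ^ N)) * \<bar>K\<bar>"
        using elim by (intro mult_right_mono) auto
      finally show ?case by (simp add: norm_power mult_ac)
    qed
  qed
  moreover have "L (?g u) = L (f u) - (\<Sum>j<N. L (fps_nth A j) * of_real u ^ j)" for u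
  proof -
    have "L (x * of_real u ^ j) = L x * of_real u ^ j" for x j
      using scaleR[of "u ^ j" x] by (simp add: scaleR_conv_of_real mult.commute)
    then show ?thesis by (simp add: diff sum)
  qed
  ultimately show "(\<lambda>u. L (f u) - (\<Sum>j<N. fps_nth (Abs_fps (\<lambda>n. L (fps_nth A n))) j * of_real u ^ j))
      \<in> O[nhds 0](\<lambda>u. of_real u ^ N)" by simp
qed

text \<open>Once the coefficients below \<open>n\<close> agree, subtracting the remainders of order
  \<open>n + 1\<close> leaves a monomial of degree \<open>n\<close> that is O(u^(n+1)); dividing by
  \<open>u^n\<close> and letting \<open>u\<close> tend to 0 shows that its coefficient is 0.\<close>

lemma asym_expansion_unique:
  fixes f :: "real \<Rightarrow> 'a::real_normed_field"
  assumes A: "asym_expansion f A" and B: "asym_expansion f B"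
  shows "A = B"
proof (rule fps_ext)
  fix n
  show "fps_nth A n = fps_nth B n"
  proof (induction n rule: less_induct)
    case (less n)
    have "(\<lambda>u. (f u - (\<Sum>j<Suc n. fps_nth B j * of_real u ^ j)) - (f u - (\<Sum>j<Suc n. fps_nth A j * of_real u ^ j)))
            \<in> O[nhds 0](\<lambda>u. (of_real u :: 'a) ^ Suc n)"
      by (intro sum_in_bigo asym_expansionD A B)
    also have "(\<lambda>u. (f u - (\<Sum>j<Suc n. fps_nth B j * of_real u ^ j)) - (f u - (\<Sum>j<Suc n. fps_nth A j * of_real u ^ j)))
       = (\<lambda>u. (fps_nth A n - fps_nth B n) * of_real u ^ n)"
      using less by (auto simp: algebra_simps)
    finally obtain C where C: "\<forall>\<^sub>F u in nhds (0::real).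
        norm ((fps_nth A n - fps_nth B n) * of_real u ^ n) \<le> C * norm ((of_real u :: 'a) ^ Suc n)"
      by (rule landau_o.bigE)
    have "\<forall>\<^sub>F u in at (0::real). u \<noteq> 0" by (simp add: eventually_at_filter)
    moreover have "\<forall>\<^sub>F u in at (0::real).
        norm ((fps_nth A n - fps_nth B n) * of_real u ^ n) \<le> C * norm ((of_real u :: 'a) ^ Suc n)"
      using C unfolding eventually_at_filter by (rule eventually_mono) auto
    ultimately have "\<forall>\<^sub>F u in at (0::real). norm (fps_nth A n - fps_nth B n) \<le> C * \<bar>u\<bar>"
    proof eventually_elim
      case (elim u)
      then have "norm (fps_nth A n - fps_nth B n) * \<bar>u\<bar> ^ n \<le> (C * \<bar>u\<bar>) * \<bar>u\<bar> ^ n"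
        by (simp add: norm_mult norm_power mult_ac)
      then show ?case using elim(1) by (simp add: mult_le_cancel_right)
    qed
    moreover have "((\<lambda>u::real. C * \<bar>u\<bar>) \<longlongrightarrow> 0) (at 0)"
      by (rule tendsto_eq_intros filterlim_ident refl | simp)+
    ultimately have "norm (fps_nth A n - fps_nth B n) \<le> 0"
      by (intro tendsto_lowerbound) auto
    then show ?case by simp
  qed
qed

section \<open>Composition with convergent power series\<close>

lemma power_series_remainder_bigo:
  fixes g :: "'a::{real_normed_field,banach} \<Rightarrow> 'a"
  assumes r: "r > 0" and g: "\<And>z. norm z < r \<Longrightarrow> (\<lambda>n. fps_nth G n * z ^ n) sums g z"
  shows "(\<lambda>z. g z - (\<Sum>n<N. fps_nth G n * z ^ n)) \<in> O[nhds 0](\<lambda>z. z ^ N)"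
proof -
  \<comment> \<open>Convergence at \<open>3 * r / 4\<close> gives absolute convergence at the
    smaller radius \<open>r / 2\<close>; for \<open>z\<close> within that radius the tail from index
    \<open>N\<close> on is at most \<open>C * norm (z ^ N)\<close>.\<close>
  let ?w = "of_real (r / 2) :: 'a"
  have abs: "summable (\<lambda>n. norm (fps_nth G n * ?w ^ n))"
  proof (rule powser_insidea)
    show "summable (\<lambda>n. fps_nth G n * of_real (3 * r / 4) ^ n)"
      using g[of "of_real (3 * r / 4)"] r by (auto simp: sums_iff)
  qed (use r in auto)
  then have absN: "summable (\<lambda>n. norm (fps_nth G (n + N)) * (r / 2) ^ n)"
  proof -
    have "summable (\<lambda>n. norm (fps_nth G (n + N) * ?w ^ (n + N)) / (r / 2) ^ N)"
      by (intro summable_divide summable_ignore_initial_segment[OF abs])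
    then show ?thesis
      using r by (simp add: norm_mult norm_power power_add)
  qed
  define C where "C = (\<Sum>n. norm (fps_nth G (n + N)) * (r / 2) ^ n)"
  show ?thesis
  proof (rule bigoI[where c = C])
    have "eventually (\<lambda>z::'a. norm z < r / 2) (nhds 0)"
      using eventually_nhds_metric[of "\<lambda>z::'a. norm z < r / 2" 0] r by (auto intro!: exI[of _ "r / 2"])
    then show "\<forall>\<^sub>F z in nhds 0. norm (g z - (\<Sum>n<N. fps_nth G n * z ^ n)) \<le> C * norm (z ^ N)"
    proof eventually_elim
      case (elim z)
      then have z: "norm z < r" using r by simp
      have bound: "norm (fps_nth G (n + N) * z ^ (n + N)) \<le> (norm (fps_nth G (n + N)) * (r / 2) ^ n) * norm (z ^ N)" for n
      proof -
        have "norm (fps_nth G (n + N) * z ^ (n + N)) = (norm (fps_nth G (n + N)) * norm z ^ n) * norm (z ^ N)"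
          by (simp add: norm_mult norm_power power_add)
        also have "\<dots> \<le> (norm (fps_nth G (n + N)) * (r / 2) ^ n) * norm (z ^ N)"
          using elim by (intro mult_right_mono mult_left_mono power_mono) auto
        finally show ?thesis .
      qed
      have sums: "(\<lambda>n. fps_nth G (n + N) * z ^ (n + N)) sums (g z - (\<Sum>n<N. fps_nth G n * z ^ n))"
        using g[OF z] by (subst sums_iff_shift) simp
      have "norm (\<Sum>n. fps_nth G (n + N) * z ^ (n + N)) \<le> (\<Sum>n. (norm (fps_nth G (n + N)) * (r / 2) ^ n) * norm (z ^ N))"
        using bound by (intro norm_suminf_le summable_mult2 absN) auto
      also have "\<dots> = C * norm (z ^ N)"
        unfolding C_def by (rule suminf_mult2[symmetric, OF absN])
      finally show ?case using sums by (simp add: sums_iff)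
    qed
  qed
qed

text \<open>The zero constant term makes \<open>f u\<close> O(u), so the power series remainder of
  order \<open>N\<close> at \<open>f u\<close> is O(u^N). Since \<open>A ^ n\<close> begins in
  degree \<open>n\<close> or later, the discarded powers do not affect the coefficients of
  \<open>G oo A\<close> below \<open>N\<close>.\<close>

lemma asym_expansion_compose:
  fixes f :: "real \<Rightarrow> 'a::{real_normed_field,banach}"
  assumes f: "asym_expansion f A" and A0: "fps_nth A 0 = 0"
    and r: "r > 0" and g: "\<And>z. norm z < r \<Longrightarrow> (\<lambda>n. fps_nth G n * z ^ n) sums g z"
  shows "asym_expansion (\<lambda>u. g (f u)) (G oo A)"
  unfolding asym_expansion_def
proof
  fix N
  let ?O = "O[nhds 0](\<lambda>u::real. (of_real u :: 'a) ^ N)"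
  have f1: "f \<in> O[nhds 0](\<lambda>u. of_real u)"
    using asym_expansionD[OF f, of 1] A0 by simp
  have lim: "(f \<longlongrightarrow> 0) (nhds 0)"
  proof -
    from f1 obtain C where "\<forall>\<^sub>F u in nhds 0. norm (f u) \<le> C * norm (of_real u :: 'a)"
      by (auto elim!: landau_o.bigE)
    moreover have "((\<lambda>u::real. C * norm (of_real u :: 'a)) \<longlongrightarrow> 0) (nhds 0)"
      by (rule tendsto_eq_intros filterlim_ident refl | simp)+
    ultimately show ?thesis by (rule Lim_null_comparison)
  qed
  have "(\<lambda>u. g (f u) - (\<Sum>n<N. fps_nth G n * f u ^ n)) \<in> O[nhds 0](\<lambda>u. f u ^ N)"
    using landau_o.big.compose[OF power_series_remainder_bigo[OF r g] lim] by simp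
  also have "(\<lambda>u. f u ^ N) \<in> ?O"
    using f1 by (rule landau_o.big_power)
  finally have *: "(\<lambda>u. g (f u) - (\<Sum>n<N. fps_nth G n * f u ^ n)) \<in> ?O" .
  define B where "B = (\<Sum>n<N. fps_const (fps_nth G n) * A ^ n)"
  have "asym_expansion (\<lambda>u. \<Sum>n<N. fps_nth G n * f u ^ n) B"
    unfolding B_def by (intro asym_expansion_sum asym_expansion_cmult asym_expansion_power f)
  from asym_expansionD[OF this, of N]
  have **: "(\<lambda>u. (\<Sum>n<N. fps_nth G n * f u ^ n) - (\<Sum>j<N. fps_nth B j * of_real u ^ j)) \<in> ?O" .
  have B: "fps_nth B j = fps_nth (G oo A) j" if "j < N" for j
  proof -
    have "fps_nth B j = (\<Sum>n<N. fps_nth G n * fps_nth (A ^ n) j)"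
      by (simp add: B_def fps_sum_nth)
    also have "\<dots> = (\<Sum>n\<in>{0..j}. fps_nth G n * fps_nth (A ^ n) j)"
      using that startsby_zero_power_prefix[OF A0] by (intro sum.mono_neutral_right) auto
    finally show ?thesis by (simp add: fps_compose_nth)
  qed
  show "(\<lambda>u. g (f u) - (\<Sum>j<N. fps_nth (G oo A) j * of_real u ^ j)) \<in> ?O"
    using sum_in_bigo(1)[OF * **] B by simp
qed

lemma asym_expansion_exp:
  fixes f :: "real \<Rightarrow> 'a::{real_normed_field,banach}"
  assumes "asym_expansion f A" "fps_nth A 0 = 0"
  shows "asym_expansion (\<lambda>u. exp (f u)) (fps_exp 1 oo A)"
proof (rule asym_expansion_compose[OF assms, of 1])
  show "(\<lambda>n. fps_nth (fps_exp 1) n * z ^ n) sums exp z" for z :: 'a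
    using exp_converges[of z] by (simp add: scaleR_conv_of_real field_simps)
qed simp

lemma asym_expansion_ln:
  fixes f :: "real \<Rightarrow> real"
  assumes "asym_expansion f A" "fps_nth A 0 = 1"
  shows "asym_expansion (\<lambda>u. ln (f u)) (fps_ln 1 oo (A - 1))"
proof -
  have "asym_expansion (\<lambda>u. f u + (-1)) (A + fps_const (-1))"
    by (intro asym_expansion_add asym_expansion_const assms)
  then have "asym_expansion (\<lambda>u. f u - 1) (A - 1)"
    by (simp flip: fps_const_neg)
  then have "asym_expansion (\<lambda>u. ln (1 + (f u - 1))) (fps_ln 1 oo (A - 1))"
  proof (rule asym_expansion_compose[where r = 1])
    fix z :: real assume "norm z < 1"
    then show "(\<lambda>n. fps_nth (fps_ln 1) n * z ^ n) sums ln (1 + z)"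
      using ln_series'[of z]
    proof (rule_tac sums_cong[THEN iffD1, rotated])
      show "- ((- z) ^ n) / real n = fps_nth (fps_ln 1) n * z ^ n" for n
        by (cases n) (auto simp: fps_ln_nth power_minus[of z])
    qed auto
  qed (use assms in auto)
  then show ?thesis by simp
qed

lemma asym_expansion_partial_sumsI:
  fixes c :: "nat \<Rightarrow> 'a::real_normed_field"
  assumes "\<And>n. n \<ge> m \<Longrightarrow> \<exists>C. \<forall>u. norm (f u - (\<Sum>j\<le>n. c j * of_real u ^ j)) \<le> C * \<bar>u\<bar> ^ n"
  shows "asym_expansion f (Abs_fps c)"
  unfolding asym_expansion_def
proof
  fix N
  let ?O = "O[nhds 0](\<lambda>u::real. (of_real u :: 'a) ^ N)"
  define n where "n = max m N"
  obtain C where C: "\<And>u. norm (f u - (\<Sum>j\<le>n. c j * of_real u ^ j)) \<le> C * \<bar>u\<bar> ^ n"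
    using assms[of n] unfolding n_def by auto
  have "(\<lambda>u. f u - (\<Sum>j\<le>n. c j * of_real u ^ j)) \<in> O[nhds 0](\<lambda>u. of_real u ^ n)"
    using C by (intro bigoI[where c = C]) (auto simp: norm_power)
  also have "(\<lambda>u. of_real u ^ n) \<in> ?O"
    by (rule of_real_power_bigo_mono) (simp add: n_def)
  finally have "(\<lambda>u. f u - (\<Sum>j\<le>n. c j * of_real u ^ j)) \<in> ?O" .
  moreover have "(\<lambda>u. \<Sum>j\<in>{N..n}. c j * of_real u ^ j) \<in> ?O"
  proof (rule big_sum_in_bigo)
    fix j assume "j \<in> {N..n}"
    then show "(\<lambda>u. c j * of_real u ^ j) \<in> ?O"
      using of_real_power_bigo_mono[of N j, where 'a = 'a] by (cases "c j = 0") auto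
  qed
  ultimately have "(\<lambda>u. (f u - (\<Sum>j\<le>n. c j * of_real u ^ j)) + (\<Sum>j\<in>{N..n}. c j * of_real u ^ j)) \<in> ?O"
    by (rule sum_in_bigo)
  moreover have "(\<Sum>j\<le>n. c j * of_real u ^ j) = (\<Sum>j<N. c j * of_real u ^ j) + (\<Sum>j\<in>{N..n}. c j * of_real u ^ j)" for u
    by (subst sum.union_disjoint[symmetric]) (auto intro!: sum.cong simp: n_def)
  ultimately show "(\<lambda>u. f u - (\<Sum>j<N. fps_nth (Abs_fps c) j * of_real u ^ j)) \<in> ?O"
    by simp
qed

section \<open>Finiteness of even moments\<close>

text \<open>Up to sign this is an \<open>n\<close>-th finite difference of a polynomial of degree
  \<open>i < n\<close>. It is \<open>i!\<close> times the coefficient of \<open>u^i\<close> in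
  \<open>(1 - e^u)^n e^(-c u)\<close>, a series divisible by \<open>u^n\<close>. The shift
  \<open>c\<close> allows central differences.\<close>

lemma alternating_binomial_power_sum_eq_0:
  fixes c :: real
  assumes "i < n"
  shows "(\<Sum>j\<le>n. (-1) ^ j * of_nat (n choose j) * (of_nat j - c) ^ i) = 0"
proof -
  let ?E = "fps_exp :: real \<Rightarrow> real fps"
  have "(- ?E 1) ^ j = (-1) ^ j * ?E (of_nat j)" for j
    by (simp add: power_minus[of "?E 1"] fps_exp_power_mult)
  then have "(- ?E 1 + 1) ^ n * ?E (- c)
      = (\<Sum>j\<le>n. of_nat (n choose j) * ((-1) ^ j * ?E (of_nat j)) * ?E (- c))"
    unfolding binomial_ring sum_distrib_right by simp
  also have "\<dots> = (\<Sum>j\<le>n. fps_const (of_nat (n choose j) * (-1) ^ j) * ?E (of_nat j - c))"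
  proof (rule sum.cong)
    fix j
    have "?E (of_nat j - c) = ?E (of_nat j) * ?E (- c)"
      by (simp flip: fps_exp_add_mult)
    moreover have "fps_const (of_nat (n choose j) * (-1) ^ j) = of_nat (n choose j) * (-1 :: real fps) ^ j"
      by (cases "even j") (simp_all add: fps_of_nat flip: fps_const_mult fps_const_neg)
    ultimately show "of_nat (n choose j) * ((-1) ^ j * ?E (of_nat j)) * ?E (- c)
        = fps_const (of_nat (n choose j) * (-1) ^ j) * ?E (of_nat j - c)"
      by (simp add: mult_ac)
  qed simp
  finally have "fps_nth ((- ?E 1 + 1) ^ n * ?E (- c)) i
      = (\<Sum>j\<le>n. (-1) ^ j * of_nat (n choose j) * (of_nat j - c) ^ i) / fact i"
    by (simp add: fps_sum_nth sum_divide_distrib mult_ac)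
  moreover have "fps_nth ((- ?E 1 + 1) ^ n * ?E (- c)) i = 0"
    using startsby_zero_power_prefix[of "- ?E 1 + 1" n] assms
    by (auto simp: fps_mult_nth intro!: sum.neutral)
  ultimately show ?thesis by simp
qed

text \<open>Real part of the binomial expansion of \<open>((1 - e^(i y))^2 e^(-i y))^k\<close>,
  whose base is \<open>2 cos y - 2\<close>; the factor \<open>e^(-i k y)\<close> centres the
  frequencies.\<close>

lemma two_minus_two_cos_power:
  fixes y :: real
  shows "(2 - 2 * cos y) ^ k
     = (-1) ^ k * (\<Sum>j\<le>2*k. (-1) ^ j * of_nat (2*k choose j) * cos ((of_nat j - of_nat k) * y))"
proof -
  have "(\<Sum>j\<le>2*k. (-1) ^ j * of_nat (2*k choose j) * cis ((of_nat j - of_nat k) * y))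
      = (\<Sum>j\<le>2*k. of_nat (2*k choose j) * (- cis y) ^ j * 1 ^ (2 * k - j)) * cis (- (of_nat k * y))"
    unfolding sum_distrib_right
    by (intro sum.cong refl) (simp add: power_minus[of "cis y"] Complex.DeMoivre cis_mult algebra_simps)
  also have "\<dots> = (- cis y + 1) ^ (2 * k) * cis (- y) ^ k"
    unfolding binomial_ring[symmetric] by (simp add: Complex.DeMoivre)
  also have "\<dots> = ((- cis y + 1) ^ 2 * cis (- y)) ^ k"
    by (simp add: power_mult power_mult_distrib)
  also have "(- cis y + 1) ^ 2 * cis (- y) = of_real (2 * cos y - 2)"
  proof -
    have "(- cis y + 1) ^ 2 * cis (- y) = cis y * (cis y * cis (-y)) - 2 * (cis y * cis (- y)) + cis (- y)"
      by (simp add: power2_eq_square algebra_simps)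
    also have "\<dots> = of_real (2 * cos y - 2)"
      by (simp add: cis_mult complex_eq_iff)
    finally show ?thesis .
  qed
  finally have "Re (\<Sum>j\<le>2*k. (-1) ^ j * of_nat (2*k choose j) * cis ((of_nat j - of_nat k) * y))
      = Re (of_real ((2 * cos y - 2) ^ k))"
    by (simp only: of_real_power)
  moreover have "Re ((-1) ^ j * of_nat m * z) = (-1) ^ j * of_nat m * Re z" for j m z
    by (cases "even j") simp_all
  ultimately have "(\<Sum>j\<le>2*k. (-1) ^ j * of_nat (2*k choose j) * cos ((of_nat j - of_nat k) * y))
      = (2 * cos y - 2) ^ k"
    by (simp del: of_real_power)
  then show ?thesis
    by (simp flip: power_mult_distrib)
qed

text \<open>Provides an integrable majorant, since a Levy measure integrates
  \<open>min 1 (x^2)\<close>. Small \<open>x\<close> use \<open>1 - cos y = 2 sin(y/2)^2\<close>,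
  large \<open>x\<close> use \<open>|cos y - 1| <= 2\<close>.\<close>

lemma abs_cos_minus_1_le: "\<bar>cos (u * x) - 1\<bar> \<le> (2 + u\<^sup>2) * min 1 (x\<^sup>2)" for u x :: real
proof (cases "x\<^sup>2 \<le> 1")
  case True
  have "\<bar>cos (u * x) - 1\<bar> = 2 * (sin (u * x / 2))\<^sup>2"
    using cos_double_sin[of "u * x / 2"] by simp
  also have "\<dots> \<le> 2 * (u * x / 2)\<^sup>2"
    using abs_sin_x_le_abs_x[of "u * x / 2"] unfolding abs_le_square_iff by simp
  also have "\<dots> \<le> u\<^sup>2 * x\<^sup>2"
    by (simp add: power_divide power_mult_distrib)
  also have "\<dots> \<le> (2 + u\<^sup>2) * x\<^sup>2"
    by (simp add: algebra_simps)
  finally show ?thesis using True by simp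
next
  case False
  have "\<bar>cos (u * x) - 1\<bar> \<le> 2 + u\<^sup>2"
    using cos_le_one[of "u * x"] cos_ge_minus_one[of "u * x"] zero_le_power2[of u] by linarith
  then show ?thesis using False by (simp add: min_def)
qed

text \<open>Since \<open>2 - 2 cos(h x) = (2 sin(h x / 2))^2\<close>, the limit is an even power of
  the derivative of \<open>2 sin(h x / 2)\<close> in \<open>h\<close> at 0.\<close>

lemma two_minus_two_cos_limit:
  "((\<lambda>h. ((2 - 2 * cos (h * x)) / h\<^sup>2) ^ k) \<longlongrightarrow> x ^ (2 * k)) (at 0)" for x :: real
proof -
  have "((\<lambda>h. 2 * sin (h * x / 2)) has_real_derivative x) (at 0)"
    by (auto intro!: derivative_eq_intros)
  then have "((\<lambda>h. 2 * sin (h * x / 2) / h) \<longlongrightarrow> x) (at 0)"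
    by (simp add: DERIV_def)
  then have "((\<lambda>h. (2 * sin (h * x / 2) / h) ^ (2 * k)) \<longlongrightarrow> x ^ (2 * k)) (at 0)"
    by (rule tendsto_power)
  moreover have "2 - 2 * cos (h * x) = (2 * sin (h * x / 2))\<^sup>2" for h
    using cos_double_sin[of "h * x / 2"] by (simp add: power_mult_distrib)
  ultimately show ?thesis
    by (simp add: power_divide power_mult)
qed

text \<open>The central difference of order \<open>2 * k\<close> of \<open>u \<mapsto> cos (u * x) - 1\<close> with step \<open>h\<close> is
  \<open>(-1) ^ k * (2 - 2 * cos (h * x)) ^ k\<close>, and it annihilates all Taylor coefficients of order
  below \<open>2 * k\<close>. So the \<open>\<nu>\<close>-integral of its quotient by \<open>h ^ (2 * k)\<close> is bounded, and Fatou's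
  lemma applies as \<open>h\<close> tends to 0.\<close>
lemma integrable_even_power_if_asym_expansion:
  fixes \<nu> :: "real measure"
  assumes sets[measurable_cong]: "sets \<nu> = sets borel"
    and int: "integrable \<nu> (\<lambda>x. min 1 (x\<^sup>2))"
    and asym: "asym_expansion (\<lambda>u. LINT x|\<nu>. cos (u * x) - 1) A"
    and k: "k \<ge> 1"
  shows "integrable \<nu> (\<lambda>x. x ^ (2 * k))"
proof -
  define r where "r u = (LINT x|\<nu>. cos (u * x) - 1)" for u
  define w where "w j = (-1) ^ j * real (2*k choose j)" for j
  define c where "c j = real j - real k" for j
  have int_cos: "integrable \<nu> (\<lambda>x. cos (u * x) - 1)" for u
  proof (rule Bochner_Integration.integrable_bound[OF integrable_mult_right[OF int, of "2 + u\<^sup>2"]])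
    show "AE x in \<nu>. norm (cos (u * x) - 1) \<le> norm ((2 + u\<^sup>2) * min 1 (x\<^sup>2))"
      using order.trans[OF abs_cos_minus_1_le abs_ge_self] by (intro AE_I2) (simp only: real_norm_def)
  qed measurable
  \<comment> \<open>The weights sum to 0, so each \<open>cos\<close> may be replaced by
    \<open>cos - 1\<close>, which unlike a nonzero constant is integrable even if
    \<open>\<nu>\<close> is infinite.\<close>
  have w0: "(\<Sum>j\<le>2*k. w j) = 0"
    using alternating_binomial_power_sum_eq_0[of 0 "2 * k" 0] k by (simp add: w_def)
  have pow: "(2 - 2 * cos (h * x)) ^ k = (-1) ^ k * (\<Sum>j\<le>2*k. w j * (cos (c j * h * x) - 1))" for h x
    unfolding two_minus_two_cos_power
    using w0 by (simp add: w_def c_def right_diff_distrib sum_subtractf mult_ac)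
  have int_pow: "integrable \<nu> (\<lambda>x. (2 - 2 * cos (h * x)) ^ k)" for h
    unfolding pow by (intro integrable_mult_right Bochner_Integration.integrable_sum int_cos)
  have lint_pow: "(LINT x|\<nu>. (2 - 2 * cos (h * x)) ^ k) = (-1) ^ k * (\<Sum>j\<le>2*k. w j * r (c j * h))" for h
    unfolding pow r_def using int_cos by simp
  define B where "B = (\<Sum>j\<le>2*k. fps_const (w j) * Abs_fps (\<lambda>n. of_real (c j) ^ n * fps_nth A n))"
  have "asym_expansion (\<lambda>h. \<Sum>j\<le>2*k. w j * r (c j * h)) B"
    unfolding B_def
    by (intro asym_expansion_sum asym_expansion_cmult asym_expansion_scale) (use asym in \<open>simp add: r_def\<close>)
  moreover have "fps_nth B n = 0" if "n < 2 * k" for n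
  proof -
    have "fps_nth B n = (\<Sum>j\<le>2*k. w j * c j ^ n) * fps_nth A n"
      unfolding sum_distrib_right by (simp add: B_def fps_sum_nth mult_ac)
    then show ?thesis
      using alternating_binomial_power_sum_eq_0[OF that, of "real k"] by (simp add: w_def c_def)
  qed
  ultimately have "(\<lambda>h. \<Sum>j\<le>2*k. w j * r (c j * h)) \<in> O[nhds 0](\<lambda>h. h ^ (2 * k))"
    using asym_expansionD[of _ B "2 * k"] by simp
  then obtain C where C: "\<forall>\<^sub>F h in nhds 0. norm (\<Sum>j\<le>2*k. w j * r (c j * h)) \<le> C * norm (h ^ (2 * k))"
    by (rule landau_o.bigE)
  \<comment> \<open>Fatou's lemma works along a sequence; this one tends to 0 without taking the
    value 0, by which the quotient cannot be divided.\<close>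
  define h where "h n = inverse (real (Suc n))" for n
  have h0: "h \<longlonglongrightarrow> 0" unfolding h_def by (rule LIMSEQ_inverse_real_of_nat)
  have h_pos: "h n > 0" for n by (simp add: h_def)
  have h_at: "filterlim h (at 0) sequentially"
    using h0 by (auto simp: filterlim_at h_def)
  let ?q = "\<lambda>n x. ((2 - 2 * cos (h n * x)) / (h n)\<^sup>2) ^ k"
  have q_nonneg: "?q n x \<ge> 0" for n x
    by (rule zero_le_power, rule divide_nonneg_nonneg) auto
  have bound: "\<forall>\<^sub>F n in sequentially. (\<integral>\<^sup>+x. ennreal (?q n x) \<partial>\<nu>) \<le> ennreal C"
    using eventually_compose_filterlim[OF C h0]
  proof (elim eventually_mono)
    fix n assume *: "norm (\<Sum>j\<le>2*k. w j * r (c j * h n)) \<le> C * norm (h n ^ (2 * k))"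
    have int_q: "integrable \<nu> (?q n)"
      unfolding power_divide by (intro integrable_divide int_pow)
    have "(LINT x|\<nu>. ?q n x) = (LINT x|\<nu>. (2 - 2 * cos (h n * x)) ^ k) / (h n)\<^sup>2 ^ k"
      unfolding power_divide by simp
    also have "\<dots> \<le> C"
    proof -
      have "(LINT x|\<nu>. (2 - 2 * cos (h n * x)) ^ k) \<le> \<bar>(-1) ^ k * (\<Sum>j\<le>2*k. w j * r (c j * h n))\<bar>"
        unfolding lint_pow by (rule abs_ge_self)
      also have "\<dots> = norm (\<Sum>j\<le>2*k. w j * r (c j * h n))"
        by (simp add: abs_mult)
      also note *
      finally show ?thesis using h_pos[of n] by (simp add: divide_simps power_mult)
    qed
    finally show "(\<integral>\<^sup>+x. ennreal (?q n x) \<partial>\<nu>) \<le> ennreal C"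
      using q_nonneg by (subst nn_integral_eq_integral[OF int_q]) (auto intro!: ennreal_leI)
  qed
  have lim: "(\<lambda>n. ennreal (?q n x)) \<longlonglongrightarrow> ennreal (x ^ (2 * k))" for x
    by (intro tendsto_ennrealI filterlim_compose[OF two_minus_two_cos_limit h_at])
  have "(\<integral>\<^sup>+x. ennreal (x ^ (2 * k)) \<partial>\<nu>) = (\<integral>\<^sup>+x. liminf (\<lambda>n. ennreal (?q n x)) \<partial>\<nu>)"
    by (intro nn_integral_cong) (use lim in \<open>auto intro!: lim_imp_Liminf[symmetric]\<close>)
  also have "\<dots> \<le> liminf (\<lambda>n. \<integral>\<^sup>+x. ennreal (?q n x) \<partial>\<nu>)"
    by (intro nn_integral_liminf) measurable
  also have "\<dots> \<le> liminf (\<lambda>n. ennreal C)"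
    by (rule Liminf_mono[OF bound])
  also have "\<dots> < \<infinity>"
    by (simp add: Liminf_const)
  finally show ?thesis
    by (intro integrableI_nonneg) (auto simp: power_mult)
qed

section \<open>Cumulants from the Levy-Khintchine formula\<close>

text \<open>The substitution of \<open>c u\<close> for \<open>u\<close> commutes with products of
  series. With \<open>c = \<i>\<close> it relates expansions of characteristic functions to real
  moment series.\<close>

lemma fps_power_twist_nth:
  fixes A :: "complex fps" and B :: "real fps"
  assumes "\<And>n. fps_nth A n = c ^ n * of_real (fps_nth B n)"
  shows "fps_nth (A ^ k) n = c ^ n * of_real (fps_nth (B ^ k) n)"
proof (induction k arbitrary: n)
  case (Suc k)
  have "c ^ i * of_real (fps_nth B i) * (c ^ (n - i) * of_real (fps_nth (B ^ k) (n - i)))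
      = c ^ n * of_real (fps_nth B i * fps_nth (B ^ k) (n - i))" if "i \<le> n" for i
  proof -
    have "c ^ n = c ^ i * c ^ (n - i)" using that by (simp flip: power_add)
    then show ?thesis by simp
  qed
  then show ?case
    unfolding power_Suc fps_mult_nth assms Suc.IH of_real_sum sum_distrib_left
    by (intro sum.cong refl) auto
qed simp

lemma fps_exp_compose_twist_nth:
  fixes A :: "complex fps" and B :: "real fps"
  assumes "\<And>n. fps_nth A n = c ^ n * of_real (fps_nth B n)"
  shows "fps_nth (fps_exp 1 oo A) n = c ^ n * of_real (fps_nth (fps_exp 1 oo B) n)"
  by (simp add: fps_compose_nth fps_power_twist_nth[OF assms] sum_distrib_left)

text \<open>On \<open>{-1..1}\<close> the compensator turns the integrand into a first-order Taylor
  remainder; elsewhere the compensator vanishes and two terms of modulus 1 remain.\<close>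

lemma norm_levy_khintchine_integrand_le:
  "norm (iexp (u * x) - 1 - \<i> * complex_of_real (u * x * indicator {-1..1} x)) \<le> (2 + u\<^sup>2) * min 1 (x\<^sup>2)"
proof (cases "x \<in> {-1..1}")
  case True
  then have x: "x\<^sup>2 \<le> 1" by (simp add: abs_square_le_1 abs_le_iff)
  have "norm (iexp (u * x) - 1 - \<i> * complex_of_real (u * x * indicator {-1..1} x)) \<le> \<bar>u * x\<bar>\<^sup>2 / 2"
    using iexp_approx1[of "u * x" 1] True by (simp add: power2_eq_square algebra_simps)
  also have "\<dots> \<le> (2 + u\<^sup>2) * x\<^sup>2"
    by (simp add: power_mult_distrib algebra_simps)
  finally show ?thesis using x by simp
next
  case False
  then have x: "x\<^sup>2 > 1" using abs_square_le_1[of x] by (auto simp: abs_le_iff)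
  have "norm (iexp (u * x) - 1) \<le> norm (iexp (u * x)) + 1"
    using norm_triangle_ineq4[of "iexp (u * x)" 1] by simp
  also have "\<dots> \<le> 2 + u\<^sup>2" by simp
  finally show ?thesis using x False by (simp add: min_def)
qed

lemma integrable_levy_khintchine_integrand:
  assumes [measurable_cong]: "sets \<nu> = sets borel" and int: "integrable \<nu> (\<lambda>x. min 1 (x\<^sup>2))"
  shows "integrable \<nu> (\<lambda>x. iexp (u * x) - 1 - \<i> * complex_of_real (u * x * indicator {-1..1} x))"
    (is "integrable _ ?g")
proof (rule Bochner_Integration.integrable_bound[OF integrable_mult_right[OF int, of "2 + u\<^sup>2"]])
  show "AE x in \<nu>. norm (?g x) \<le> norm ((2 + u\<^sup>2) * min 1 (x\<^sup>2))"
    using order.trans[OF norm_levy_khintchine_integrand_le abs_ge_self]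
    by (intro AE_I2) (simp only: real_norm_def)
qed measurable

lemma (in prob_space) char_asym_expansion:
  assumes rv: "random_variable borel X"
    and mom: "\<And>k. integrable M (\<lambda>\<omega>. X \<omega> ^ k)"
  shows "asym_expansion (char (distr M borel X))
           (Abs_fps (\<lambda>n. \<i> ^ n * of_real (expectation (\<lambda>\<omega>. X \<omega> ^ n) / fact n)))"
proof (rule asym_expansion_partial_sumsI[of 0])
  fix n :: nat
  show "\<exists>C. \<forall>u. norm (char (distr M borel X) u
      - (\<Sum>j\<le>n. \<i> ^ j * of_real (expectation (\<lambda>\<omega>. X \<omega> ^ j) / fact j) * of_real u ^ j)) \<le> C * \<bar>u\<bar> ^ n"
  proof (intro exI allI)
    fix u
    have "(\<Sum>j\<le>n. \<i> ^ j * complex_of_real (expectation (\<lambda>\<omega>. X \<omega> ^ j) / fact j) * of_real u ^ j)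
        = (\<Sum>k\<le>n. ((\<i> * of_real u)^k / fact k) * of_real (expectation (\<lambda>x. X x ^ k)))"
      by (intro sum.cong) (simp_all add: power_mult_distrib)
    then show "norm (char (distr M borel X) u
      - (\<Sum>j\<le>n. \<i> ^ j * of_real (expectation (\<lambda>\<omega>. X \<omega> ^ j) / fact j) * of_real u ^ j))
        \<le> (2 / fact n * expectation (\<lambda>\<omega>. \<bar>X \<omega>\<bar> ^ n)) * \<bar>u\<bar> ^ n"
      using char_approx1'[where n = n and t = u, OF mom rv refl] by (simp add: mult_ac)
  qed
qed

text \<open>Taking moduli in the Levy-Khintchine formula removes the drift, so the integral of
  \<open>cos (u * x) - 1\<close> inherits an expansion from the characteristic function and the even
  moments are finite. Then \<open>|x|^n <= x^2 + x^(2 n)\<close> covers all orders from 2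
  on.\<close>

lemma (in prob_space) levy_measure_integrable_power:
  assumes rv: "random_variable borel X"
    and mom: "\<And>k. integrable M (\<lambda>\<omega>. X \<omega> ^ k)"
    and LK: "levy_khintchine (distr M borel X) \<sigma>2 \<nu>"
    and n: "n \<ge> 2"
  shows "integrable \<nu> (\<lambda>x. x ^ n)"
proof -
  let ?\<phi> = "char (distr M borel X)"
  let ?g = "\<lambda>u x. iexp (u * x) - 1 - \<i> * complex_of_real (u * x * indicator {-1..1} x)"
  from LK obtain b where sets[measurable_cong]: "sets \<nu> = sets borel"
    and int: "integrable \<nu> (\<lambda>x. min 1 (x\<^sup>2))"
    and \<phi>: "\<And>u. ?\<phi> u = exp (\<i> * complex_of_real (b * u) - complex_of_real (\<sigma>2 * u\<^sup>2 / 2) + (CLINT x|\<nu>. ?g u x))"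
    unfolding levy_khintchine_def by auto
  note int_g = integrable_levy_khintchine_integrand[OF sets int]
  have Re_g: "Re (CLINT x|\<nu>. ?g u x) = (LINT x|\<nu>. cos (u * x) - 1)" for u
    unfolding integral_Re[OF int_g, symmetric] by (simp add: Re_exp)
  have norm_\<phi>: "norm (?\<phi> u) = exp ((LINT x|\<nu>. cos (u * x) - 1) - \<sigma>2 * u\<^sup>2 / 2)" for u
    unfolding \<phi> norm_exp_eq_Re plus_complex.sel Re_g by simp
  \<comment> \<open>The squared modulus \<open>Re^2 + Im^2\<close> is used because ring operations
    alone give its expansion; the factor \<open>1 / 2\<close> undoes the square.\<close>
  have ln_\<phi>: "(LINT x|\<nu>. cos (u * x) - 1) = 1 / 2 * ln (Re (?\<phi> u) ^ 2 + Im (?\<phi> u) ^ 2) + \<sigma>2 / 2 * u ^ 2" for u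
  proof -
    have "ln (Re (?\<phi> u) ^ 2 + Im (?\<phi> u) ^ 2) = ln (norm (?\<phi> u) ^ 2)"
      by (simp add: cmod_power2)
    also have "\<dots> = 2 * ((LINT x|\<nu>. cos (u * x) - 1) - \<sigma>2 * u\<^sup>2 / 2)"
      unfolding norm_\<phi> by (simp add: ln_realpow)
    finally show ?thesis by (simp add: diff_divide_distrib)
  qed
  define A where "A = Abs_fps (\<lambda>n. \<i> ^ n * complex_of_real (expectation (\<lambda>\<omega>. X \<omega> ^ n) / fact n))"
  define B where "B = Abs_fps (\<lambda>n. Re (fps_nth A n)) ^ 2 + Abs_fps (\<lambda>n. Im (fps_nth A n)) ^ 2"
  have A: "asym_expansion ?\<phi> A" unfolding A_def by (rule char_asym_expansion[OF rv mom])
  have B: "asym_expansion (\<lambda>u. Re (?\<phi> u) ^ 2 + Im (?\<phi> u) ^ 2) B"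
    unfolding B_def
    by (intro asym_expansion_add asym_expansion_power asym_expansion_bounded_linear[OF A]
         bounded_linear_Re bounded_linear_Im)
  \<comment> \<open>The constant term 1 lets the logarithm series be composed with
    \<open>B - 1\<close>.\<close>
  have "fps_nth B 0 = 1" by (simp add: B_def A_def prob_space power2_eq_square)
  from asym_expansion_ln[OF B this]
  have "asym_expansion (\<lambda>u. 1 / 2 * ln (Re (?\<phi> u) ^ 2 + Im (?\<phi> u) ^ 2) + \<sigma>2 / 2 * of_real u ^ 2)
     (fps_const (1 / 2) * (fps_ln 1 oo (B - 1)) + fps_const (\<sigma>2 / 2) * fps_X ^ 2)"
    by (intro asym_expansion_add asym_expansion_cmult asym_expansion_power asym_expansion_of_real)
  then have asym: "asym_expansion (\<lambda>u. LINT x|\<nu>. cos (u * x) - 1)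
     (fps_const (1 / 2) * (fps_ln 1 oo (B - 1)) + fps_const (\<sigma>2 / 2) * fps_X ^ 2)"
    unfolding ln_\<phi> by simp
  have even: "integrable \<nu> (\<lambda>x. x ^ (2 * k))" if "k \<ge> 1" for k
    using integrable_even_power_if_asym_expansion[OF sets int asym that] .
  show ?thesis
  proof (rule Bochner_Integration.integrable_bound)
    show "integrable \<nu> (\<lambda>x. x ^ (2 * 1) + x ^ (2 * n))"
      using n by (intro Bochner_Integration.integrable_add even) auto
    show "AE x in \<nu>. norm (x ^ n) \<le> norm (x ^ (2 * 1) + x ^ (2 * n))"
    proof (rule AE_I2)
      fix x :: real
      have "\<bar>x\<bar> ^ n \<le> \<bar>x\<bar> ^ 2 + \<bar>x\<bar> ^ (2 * n)"
      proof (cases "\<bar>x\<bar> \<le> 1")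
        case True
        then have "\<bar>x\<bar> ^ n \<le> \<bar>x\<bar> ^ 2" using n by (intro power_decreasing) auto
        also have "\<dots> \<le> \<bar>x\<bar> ^ 2 + \<bar>x\<bar> ^ (2 * n)" by simp
        finally show ?thesis .
      next
        case False
        then have "\<bar>x\<bar> ^ n \<le> \<bar>x\<bar> ^ (2 * n)" by (intro power_increasing) auto
        then show ?thesis using zero_le_power2[of "\<bar>x\<bar>"] by linarith
      qed
      then show "norm (x ^ n) \<le> norm (x ^ (2 * 1) + x ^ (2 * n))"
        by (simp add: power_abs[symmetric] power_mult)
    qed
  qed measurable
qed

text \<open>Finite moments of \<open>\<nu>\<close> give the Levy-Khintchine exponent an expansion;
  by uniqueness its exponential agrees with the moment expansion of the characteristic function. The
  factors \<open>\<i> ^ n\<close> then cancel. Exponentiating, rather than taking logarithms, avoids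
  the choice of a branch.\<close>

lemma (in prob_space) moment_fps_eq_exp_cumulant_fps:
  assumes rv: "random_variable borel X"
    and mom: "\<And>k. integrable M (\<lambda>\<omega>. X \<omega> ^ k)"
    and mean: "expectation X = 0"
    and LK: "levy_khintchine (distr M borel X) \<sigma>2 \<nu>"
  defines "\<kappa> \<equiv> \<lambda>k. (if k = 2 then \<sigma>2 else 0) + (LINT x|\<nu>. x ^ k)"
  shows "Abs_fps (\<lambda>n. expectation (\<lambda>\<omega>. X \<omega> ^ n) / fact n)
       = fps_exp 1 oo Abs_fps (\<lambda>k. if k < 2 then 0 else \<kappa> k / fact k)"
proof -
  let ?\<phi> = "char (distr M borel X)"
  let ?g = "\<lambda>u x. iexp (u * x) - 1 - \<i> * complex_of_real (u * x * indicator {-1..1} x)"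
  from LK obtain b where sets[measurable_cong]: "sets \<nu> = sets borel"
    and int: "integrable \<nu> (\<lambda>x. min 1 (x\<^sup>2))"
    and \<phi>: "\<And>u. ?\<phi> u = exp (\<i> * complex_of_real (b * u) - complex_of_real (\<sigma>2 * u\<^sup>2 / 2) + (CLINT x|\<nu>. ?g u x))"
    unfolding levy_khintchine_def by auto
  note int_g = integrable_levy_khintchine_integrand[OF sets int]
  note int_pow = levy_measure_integrable_power[OF rv mom LK]
  \<comment> \<open>The formula compensates only jumps in \<open>{-1..1}\<close>, while a full
    first-order Taylor term involves the larger ones too. For these \<open>|x| <= x^2\<close>, so
    the second moment of \<open>\<nu>\<close> suffices.\<close>
  let ?t = "\<lambda>x::real. x * indicator (- {-1..1}) x"
  have int_t: "integrable \<nu> ?t"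
  proof (rule Bochner_Integration.integrable_bound[OF int_pow[of 2]])
    show "AE x in \<nu>. norm (?t x) \<le> norm (x ^ 2)"
    proof (rule AE_I2)
      fix x :: real
      show "norm (?t x) \<le> norm (x ^ 2)"
      proof (cases "\<bar>x\<bar> \<le> 1")
        case False
        then have "\<bar>x\<bar> ^ 1 \<le> \<bar>x\<bar> ^ 2" by (intro power_increasing) auto
        then show ?thesis by (auto simp: indicator_def)
      qed (auto simp: indicator_def)
    qed
  qed auto
  \<comment> \<open>First-order coefficient of the exponent: drift plus the
    \<open>\<nu>\<close>-integral of the jumps outside \<open>{-1..1}\<close>.\<close>
  define \<beta> where "\<beta> = b + (LINT x|\<nu>. ?t x)"
  define c where "c j = (if j = 0 then 0 else if j = 1 then \<beta> else \<kappa> j / fact j)" for j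
  define \<psi> where "\<psi> u = \<i> * complex_of_real (b * u) - complex_of_real (\<sigma>2 * u\<^sup>2 / 2) + (CLINT x|\<nu>. ?g u x)" for u
  have \<psi>: "asym_expansion \<psi> (Abs_fps (\<lambda>j. \<i> ^ j * of_real (c j)))"
  proof (rule asym_expansion_partial_sumsI[of 2])
    fix n :: nat assume n: "n \<ge> 2"
    show "\<exists>C. \<forall>u. norm (\<psi> u - (\<Sum>j\<le>n. \<i> ^ j * of_real (c j) * of_real u ^ j)) \<le> C * \<bar>u\<bar> ^ n"
    proof (intro exI allI)
      fix u :: real
      let ?R = "\<lambda>x. iexp (u * x) - (\<Sum>j\<le>n. (\<i> * complex_of_real (u * x)) ^ j / fact j)"
      have split: "(\<Sum>j\<le>n. f j) = f 0 + f 1 + (\<Sum>j\<in>{2..n}. f j)" for f :: "nat \<Rightarrow> complex"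
      proof -
        have "{..n} = {0, 1} \<union> {2..n}" using n by auto
        then show ?thesis by (simp add: sum.union_disjoint)
      qed
      \<comment> \<open>Neither the constant nor the linear Taylor term need be integrable against
        \<open>\<nu>\<close> by itself, so both are absorbed into the compensated integrand and
        \<open>?t\<close>.\<close>
      have R: "?R x = ?g u x - \<i> * of_real u * complex_of_real (?t x)
          - (\<Sum>j\<in>{2..n}. (\<i> * of_real u) ^ j / fact j * complex_of_real (x ^ j))" for x
        unfolding split by (auto simp: indicator_def power_mult_distrib algebra_simps)
      have int_c: "integrable \<nu> (\<lambda>x. (\<i> * of_real u) ^ j / fact j * complex_of_real (x ^ j))" if "j \<ge> 2" for j
        using int_pow[OF that] by (intro integrable_mult_right integrable_of_real)
      have int_tc: "integrable \<nu> (\<lambda>x. \<i> * of_real u * complex_of_real (?t x))"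
        using int_t by (intro integrable_mult_right integrable_of_real)
      have int_R: "integrable \<nu> ?R"
        unfolding R by (intro Bochner_Integration.integrable_diff Bochner_Integration.integrable_sum int_g int_c int_tc) auto
      have int_sum: "integrable \<nu> (\<lambda>x. \<Sum>j\<in>{2..n}. (\<i> * of_real u) ^ j / fact j * complex_of_real (x ^ j))"
        by (intro Bochner_Integration.integrable_sum int_c) auto
      have "(CLINT x|\<nu>. ?R x) = (CLINT x|\<nu>. ?g u x) - (CLINT x|\<nu>. \<i> * of_real u * complex_of_real (?t x))
          - (CLINT x|\<nu>. (\<Sum>j\<in>{2..n}. (\<i> * of_real u) ^ j / fact j * complex_of_real (x ^ j)))"
        unfolding R
        unfolding Bochner_Integration.integral_diff[OF Bochner_Integration.integrable_diff[OF int_g int_tc] int_sum]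
          Bochner_Integration.integral_diff[OF int_g int_tc] ..
      also have "(CLINT x|\<nu>. \<i> * of_real u * complex_of_real (?t x)) = \<i> * of_real u * of_real (LINT x|\<nu>. ?t x)"
        by (simp only: integral_mult_right_zero integral_complex_of_real)
      also have "(CLINT x|\<nu>. (\<Sum>j\<in>{2..n}. (\<i> * of_real u) ^ j / fact j * complex_of_real (x ^ j)))
          = (\<Sum>j\<in>{2..n}. (\<i> * of_real u) ^ j / fact j * of_real (LINT x|\<nu>. x ^ j))"
        by (subst Bochner_Integration.integral_sum)
           (use int_c in \<open>auto simp only: integral_mult_right_zero integral_complex_of_real atLeastAtMost_iff\<close>)
      also have "(CLINT x|\<nu>. ?g u x) - \<i> * of_real u * of_real (LINT x|\<nu>. ?t x)
          - (\<Sum>j\<in>{2..n}. (\<i> * of_real u) ^ j / fact j * of_real (LINT x|\<nu>. x ^ j))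
          = \<psi> u - (\<Sum>j\<le>n. \<i> ^ j * of_real (c j) * of_real u ^ j)"
      proof -
        \<comment> \<open>The Gaussian term is \<open>(\<i> u)^2 / 2\<close> times the variance and
          so enters only the coefficient of order 2.\<close>
        have "(\<Sum>j\<in>{2..n}. \<i> ^ j * of_real (c j) * of_real u ^ j)
           = (\<Sum>j\<in>{2..n}. (\<i> * of_real u) ^ j / fact j * of_real (LINT x|\<nu>. x ^ j)
               + (if j = 2 then (\<i> * of_real u) ^ 2 / 2 * of_real \<sigma>2 else 0))"
          by (intro sum.cong) (auto simp: c_def \<kappa>_def power_mult_distrib field_simps)
        also have "\<dots> = (\<Sum>j\<in>{2..n}. (\<i> * of_real u) ^ j / fact j * of_real (LINT x|\<nu>. x ^ j))
               + (\<i> * of_real u) ^ 2 / 2 * of_real \<sigma>2"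
          using n by (simp add: sum.distrib)
        finally show ?thesis
          unfolding split by (simp add: \<psi>_def c_def \<beta>_def power_mult_distrib algebra_simps)
      qed
      finally have "norm (\<psi> u - (\<Sum>j\<le>n. \<i> ^ j * of_real (c j) * of_real u ^ j)) = norm (CLINT x|\<nu>. ?R x)"
        by simp
      also have "\<dots> \<le> (LINT x|\<nu>. norm (?R x))"
        by (rule integral_norm_bound)
      also have "\<dots> \<le> (LINT x|\<nu>. 2 * \<bar>u\<bar> ^ n / fact n * \<bar>x\<bar> ^ n)"
      proof (rule integral_mono[OF integrable_norm[OF int_R]])
        show "integrable \<nu> (\<lambda>x. 2 * \<bar>u\<bar> ^ n / fact n * \<bar>x\<bar> ^ n)"
          using integrable_abs[OF int_pow[OF n]] by (intro integrable_mult_right) (simp add: power_abs)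
        show "norm (?R x) \<le> 2 * \<bar>u\<bar> ^ n / fact n * \<bar>x\<bar> ^ n" for x
          using iexp_approx2[of "u * x" n] by (simp add: abs_mult power_mult_distrib)
      qed
      also have "\<dots> = (2 / fact n * (LINT x|\<nu>. \<bar>x\<bar> ^ n)) * \<bar>u\<bar> ^ n"
        by simp
      finally show "norm (\<psi> u - (\<Sum>j\<le>n. \<i> ^ j * of_real (c j) * of_real u ^ j))
          \<le> (2 / fact n * (LINT x|\<nu>. \<bar>x\<bar> ^ n)) * \<bar>u\<bar> ^ n" .
    qed
  qed
  have "asym_expansion (\<lambda>u. exp (\<psi> u)) (fps_exp 1 oo Abs_fps (\<lambda>j. \<i> ^ j * of_real (c j)))"
    by (rule asym_expansion_exp[OF \<psi>]) (simp add: c_def)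
  moreover have "(\<lambda>u. exp (\<psi> u)) = ?\<phi>"
    by (rule ext) (simp only: \<phi> \<psi>_def)
  ultimately have "asym_expansion ?\<phi> (fps_exp 1 oo Abs_fps (\<lambda>j. \<i> ^ j * of_real (c j)))"
    by simp
  note unique = asym_expansion_unique[OF char_asym_expansion[OF rv mom] this]
  have eq: "expectation (\<lambda>\<omega>. X \<omega> ^ n) / fact n = fps_nth (fps_exp 1 oo Abs_fps c) n" for n
  proof -
    have "\<i> ^ n * complex_of_real (expectation (\<lambda>\<omega>. X \<omega> ^ n) / fact n)
        = fps_nth (fps_exp 1 oo Abs_fps (\<lambda>j. \<i> ^ j * of_real (c j))) n"
      by (simp only: unique[symmetric] fps_nth_Abs_fps)
    also have "\<dots> = \<i> ^ n * of_real (fps_nth (fps_exp 1 oo Abs_fps c) n)"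
      by (rule fps_exp_compose_twist_nth) simp
    finally show ?thesis
      by (simp only: mult_cancel_left power_eq_0_iff complex_i_not_zero of_real_eq_iff simp_thms)
  qed
  \<comment> \<open>The drift is not normalised in the representation; the mean of \<open>X\<close> determines it.\<close>
  have "\<beta> = 0"
    using eq[of 1] mean by (simp add: fps_compose_nth c_def)
  then have "c = (\<lambda>k. if k < 2 then 0 else \<kappa> k / fact k)"
    by (auto simp: c_def fun_eq_iff less_2_cases_iff)
  then show ?thesis using eq by (simp add: fps_eq_iff)
qed

section \<open>Kendall polynomials and the natural filtration\<close>

lemma fps_linear_ode_unique:
  fixes y z c :: "'a::field_char_0 fps"
  assumes y: "fps_deriv y = c * y" and z: "fps_deriv z = c * z" and "fps_nth y 0 = fps_nth z 0"
  shows "y = z"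
proof (rule fps_ext)
  fix n
  show "fps_nth y n = fps_nth z n"
  proof (induction n rule: less_induct)
    case (less n)
    show ?case
    proof (cases n)
      case (Suc m)
      have "fps_nth (c * y) m = fps_nth (c * z) m"
        unfolding fps_mult_nth using less Suc by (intro sum.cong) auto
      then have "fps_nth (fps_deriv y) m = fps_nth (fps_deriv z) m"
        by (simp only: y z)
      then show ?thesis using Suc by (simp del: of_nat_Suc)
    qed (use assms in simp)
  qed
qed

text \<open>Both sides solve the linear equation \<open>y' = (a + b)' y\<close> and have constant
  term 1.\<close>

lemma fps_exp_compose_add:
  fixes a b :: "'a::field_char_0 fps"
  assumes a: "fps_nth a 0 = 0" and b: "fps_nth b 0 = 0"
  shows "fps_exp 1 oo (a + b) = (fps_exp 1 oo a) * (fps_exp 1 oo b)"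
proof (rule fps_linear_ode_unique[where c = "fps_deriv (a + b)"])
  show "fps_deriv (fps_exp 1 oo (a + b)) = fps_deriv (a + b) * (fps_exp 1 oo (a + b))"
    using a b by (simp add: fps_compose_deriv mult_ac)
  show "fps_deriv ((fps_exp 1 oo a) * (fps_exp 1 oo b)) = fps_deriv (a + b) * ((fps_exp 1 oo a) * (fps_exp 1 oo b))"
    using a b by (simp add: fps_compose_deriv algebra_simps)
qed simp

text \<open>The cumulant series is \<open>x u\<close> minus the series of the \<open>f k\<close>, so
  its exponential factors and \<open>x\<close> enters through \<open>e^(x u)\<close> alone.\<close>

lemma kendall_shift:
  "kendall n (\<lambda>k. if k = 1 then x else - f k)
     = fact n * fps_nth (fps_exp x * (fps_exp 1 oo - Abs_fps (\<lambda>k. if k < 2 then 0 else f k / fact k))) n"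
proof -
  let ?K = "Abs_fps (\<lambda>k. if k < 2 then 0 else f k / fact k)"
  have 1: "Abs_fps (\<lambda>k. if k = 0 then 0 else (if k = 1 then x else - f k) / fact k) = fps_const x * fps_X + - ?K"
    by (auto simp: fps_eq_iff less_2_cases_iff)
  have 2: "fps_exp 1 oo (fps_const x * fps_X + - ?K) = (fps_exp 1 oo (fps_const x * fps_X)) * (fps_exp 1 oo - ?K)"
    by (rule fps_exp_compose_add) simp_all
  have 3: "fps_exp 1 oo (fps_const x * fps_X) = fps_exp x"
    by (simp add: fps_compose_linear fps_eq_iff)
  show ?thesis
    unfolding kendall_def 1 2 3 ..
qed

section \<open>The natural filtration and later increments\<close>

lemma space_natural_filtration [simp]: "space (natural_filtration M X t) = space M"
  unfolding natural_filtration_def by (subst space_measure_of) auto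

lemma sets_natural_filtration:
  "sets (natural_filtration M X t)
     = sigma_sets (space M) (\<Union>s\<in>{0..t}. {X s -` A \<inter> space M | A. A \<in> sets borel})"
  unfolding natural_filtration_def by (subst sets_measure_of) auto

lemma measurable_natural_filtration:
  assumes "0 \<le> r" "r \<le> t"
  shows "X r \<in> borel_measurable (natural_filtration M X t)"
proof (rule measurableI)
  fix A :: "real set" assume "A \<in> sets borel"
  then show "X r -` A \<inter> space (natural_filtration M X t) \<in> sets (natural_filtration M X t)"
    unfolding sets_natural_filtration using assms
    by (intro sigma_sets.Basic UN_I[of r] CollectI exI[of _ A]) auto
qed simp

lemma sets_natural_filtration_subset:
  assumes "\<And>r. 0 \<le> r \<Longrightarrow> r \<le> t \<Longrightarrow> X r \<in> borel_measurable M"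
  shows "sets (natural_filtration M X t) \<subseteq> sets M"
  unfolding sets_natural_filtration
  using assms by (intro sets.sigma_sets_subset) (auto intro: measurable_sets)

text \<open>Along the sorted times of \<open>J \<union> {0, s}\<close> followed by \<open>t\<close>,
  each \<open>X j - X 0\<close> is a partial sum of the first \<open>m\<close> increments, while
  \<open>X t - X s\<close> is the last one. Splitting the independent increments into the blocks
  \<open>{..<m}\<close> and \<open>{m}\<close> gives the product.\<close>

lemma (in prob_space) indep_cylinder_increment:
  fixes X :: "real \<Rightarrow> 'a \<Rightarrow> real"
  assumes indep_incr: "\<And>ts. sorted_wrt (<) ts \<Longrightarrow> (\<forall>t\<in>set ts. t \<ge> 0) \<Longrightarrow>
          indep_vars (\<lambda>_. borel) (\<lambda>i \<omega>. X (ts ! Suc i) \<omega> - X (ts ! i) \<omega>) {..<length ts - 1}"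
    and st: "0 \<le> s" "s < t"
    and J: "finite J" "J \<subseteq> {0..s}" and B: "\<And>j. j \<in> J \<Longrightarrow> B j \<in> sets borel" and C: "C \<in> sets borel"
  shows "prob ({\<omega>\<in>space M. \<forall>j\<in>J. X j \<omega> - X 0 \<omega> \<in> B j} \<inter> {\<omega>\<in>space M. X t \<omega> - X s \<omega> \<in> C})
       = prob {\<omega>\<in>space M. \<forall>j\<in>J. X j \<omega> - X 0 \<omega> \<in> B j} * prob {\<omega>\<in>space M. X t \<omega> - X s \<omega> \<in> C}"
proof -
  \<comment> \<open>Including 0 makes the partial sums start from \<open>X 0\<close>; including
    \<open>s\<close> makes the last increment equal to \<open>X t - X s\<close>.\<close>
  define L where "L = sorted_list_of_set (J \<union> {0, s})"
  define m where "m = length L - 1"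
  define ts where "ts = L @ [t]"
  define Y where "Y i \<omega> = X (ts ! Suc i) \<omega> - X (ts ! i) \<omega>" for i \<omega>
  have set_L: "set L = J \<union> {0, s}" unfolding L_def by (rule set_sorted_list_of_set) (use J in simp)
  have sL: "sorted_wrt (<) L" by (simp add: L_def strict_sorted_list_of_set)
  have len: "length L = Suc m"
    using set_L by (cases L) (auto simp: m_def)
  have L_le: "L ! i < L ! k" if "i < k" "k \<le> m" for i k
    using sL that len by (auto simp: sorted_wrt_iff_nth_less)
  have L_bounds: "0 \<le> r \<and> r \<le> s" if "r \<in> set L" for r using that set_L J st by auto
  have L0: "L ! 0 = 0"
  proof -
    have "0 \<in> set L" using set_L by simp
    then obtain i where "i \<le> m" "L ! i = 0" by (auto simp: in_set_conv_nth len less_Suc_eq_le)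
    moreover have "L ! 0 \<ge> 0" using L_bounds[OF nth_mem, of 0] len by simp
    ultimately show ?thesis using L_le[of 0 i] by (cases "i = 0") auto
  qed
  have Lm: "L ! m = s"
  proof -
    have "s \<in> set L" using set_L by simp
    then obtain i where "i \<le> m" "L ! i = s" by (auto simp: in_set_conv_nth len less_Suc_eq_le)
    moreover have "L ! m \<le> s" using L_bounds[OF nth_mem, of m] len by simp
    ultimately show ?thesis using L_le[of i m] by (cases "i = m") auto
  qed
  have "indep_vars (\<lambda>_. borel) (\<lambda>i \<omega>. X (ts ! Suc i) \<omega> - X (ts ! i) \<omega>) {..<length ts - 1}"
    using st L_bounds sL by (intro indep_incr) (fastforce simp: ts_def sorted_wrt_append)+
  then have Y: "indep_vars (\<lambda>_. borel) Y {..<Suc m}"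
    by (simp add: Y_def[abs_def] ts_def len)
  have "indep_var (PiM {..<m} (\<lambda>_. borel)) (\<lambda>\<omega>. restrict (\<lambda>i. Y i \<omega>) {..<m})
      (PiM {m} (\<lambda>_. borel)) (\<lambda>\<omega>. restrict (\<lambda>i. Y i \<omega>) {m})"
    by (rule indep_var_restrict[OF Y]) auto
  note indep = indep_varD[OF this]
  have Ym: "Y m \<omega> = X t \<omega> - X s \<omega>" for \<omega>
    using len Lm by (simp add: Y_def ts_def nth_append)
  have Ysum: "X (L ! i) \<omega> - X 0 \<omega> = (\<Sum>l<i. Y l \<omega>)" if "i \<le> m" for i \<omega>
  proof -
    have "(\<Sum>l<i. Y l \<omega>) = (\<Sum>l<i. X (L ! Suc l) \<omega> - X (L ! l) \<omega>)"
      using that len by (intro sum.cong) (auto simp: Y_def ts_def nth_append)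
    then show ?thesis using sum_lessThan_telescope[of "\<lambda>l. X (L ! l) \<omega>" i] by (simp add: L0)
  qed
  have "\<exists>i\<le>m. L ! i = j" if "j \<in> J" for j
  proof -
    have "j \<in> set L" using that set_L by simp
    then show ?thesis by (auto simp: in_set_conv_nth len less_Suc_eq_le)
  qed
  then obtain idx where idx: "\<And>j. j \<in> J \<Longrightarrow> idx j \<le> m" "\<And>j. j \<in> J \<Longrightarrow> L ! idx j = j"
    by metis
  \<comment> \<open>\<open>S\<close> and \<open>R\<close> express the two events through the vectors
    of the first \<open>m\<close> increments and of the last one.\<close>
  define S where "S = {f \<in> space (PiM {..<m} (\<lambda>_. borel)). \<forall>j\<in>J. (\<Sum>l<idx j. f l) \<in> B j}"
  define R where "R = {f \<in> space (PiM {m} (\<lambda>_. borel :: real measure)). f m \<in> C}"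
  have S_sets: "S \<in> sets (PiM {..<m} (\<lambda>_. borel))"
    unfolding S_def
  proof (rule sets.sets_Collect_finite_All)
    fix j assume j: "j \<in> J"
    have "(\<lambda>f. \<Sum>l<idx j. f l) \<in> borel_measurable (PiM {..<m} (\<lambda>_. borel :: real measure))"
      using idx(1)[OF j] by (intro borel_measurable_sum measurable_component_singleton) auto
    from measurable_sets[OF this B[OF j]]
    show "{f \<in> space (PiM {..<m} (\<lambda>_. borel)). (\<Sum>l<idx j. f l) \<in> B j} \<in> sets (PiM {..<m} (\<lambda>_. borel))"
      by (simp add: vimage_def Int_def conj_commute)
  qed (use J in auto)
  have R_sets: "R \<in> sets (PiM {m} (\<lambda>_. borel))"
  proof -
    have "(\<lambda>f. f m) \<in> borel_measurable (PiM {m} (\<lambda>_. borel :: real measure))"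
      by (intro measurable_component_singleton) auto
    from measurable_sets[OF this C] show ?thesis
      by (simp add: R_def vimage_def Int_def conj_commute)
  qed
  have sum_eq: "(\<Sum>l<idx j. restrict (\<lambda>i. Y i \<omega>) {..<m} l) = X j \<omega> - X 0 \<omega>" if "j \<in> J" for j \<omega>
  proof -
    have "(\<Sum>l<idx j. restrict (\<lambda>i. Y i \<omega>) {..<m} l) = (\<Sum>l<idx j. Y l \<omega>)"
      using idx(1)[OF that] by (intro sum.cong) auto
    then show ?thesis using Ysum[OF idx(1)[OF that]] idx(2)[OF that] by simp
  qed
  have 1: "(\<lambda>\<omega>. restrict (\<lambda>i. Y i \<omega>) {..<m}) -` S \<inter> space M = {\<omega>\<in>space M. \<forall>j\<in>J. X j \<omega> - X 0 \<omega> \<in> B j}"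
  proof -
    have "restrict (\<lambda>i. Y i \<omega>) {..<m} \<in> space (PiM {..<m} (\<lambda>_. borel))" for \<omega>
      by (simp add: space_PiM)
    then show ?thesis by (auto simp: S_def sum_eq simp del: restrict_apply)
  qed
  have 2: "(\<lambda>\<omega>. restrict (\<lambda>i. Y i \<omega>) {m}) -` R \<inter> space M = {\<omega>\<in>space M. X t \<omega> - X s \<omega> \<in> C}"
    by (auto simp: R_def space_PiM Ym)
  have 3: "(\<lambda>x. (\<lambda>i\<in>{..<m}. Y i x, \<lambda>i\<in>{m}. Y i x)) -` (S \<times> R) \<inter> space M
      = {\<omega>\<in>space M. \<forall>j\<in>J. X j \<omega> - X 0 \<omega> \<in> B j} \<inter> {\<omega>\<in>space M. X t \<omega> - X s \<omega> \<in> C}"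
    unfolding 1[symmetric] 2[symmetric] by auto
  show ?thesis
    using indep[OF S_sets R_sets] unfolding 1 2 3 .
qed

text \<open>Finite-dimensional cylinders over \<open>{0..s}\<close> are stable under intersection
  and generate a sigma-algebra containing the past, so their independence of the increment extends
  to the past and hence to \<open>Z\<close>.\<close>

lemma (in prob_space) indep_natural_filtration_increment:
  fixes X :: "real \<Rightarrow> 'a \<Rightarrow> real"
  assumes meas: "\<And>t. t \<ge> 0 \<Longrightarrow> X t \<in> borel_measurable M"
    and X0: "AE \<omega> in M. X 0 \<omega> = 0"
    and indep_incr: "\<And>ts. sorted_wrt (<) ts \<Longrightarrow> (\<forall>t\<in>set ts. t \<ge> 0) \<Longrightarrow>
          indep_vars (\<lambda>_. borel) (\<lambda>i \<omega>. X (ts ! Suc i) \<omega> - X (ts ! i) \<omega>) {..<length ts - 1}"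
    and st: "0 \<le> s" "s < t"
    and Z: "Z \<in> borel_measurable (natural_filtration M X s)"
  shows "indep_var borel Z borel (\<lambda>\<omega>. X t \<omega> - X s \<omega>)"
proof -
  define D where "D \<omega> = X t \<omega> - X s \<omega>" for \<omega>
  have D_meas[measurable]: "D \<in> borel_measurable M"
    using meas st unfolding D_def[abs_def] by simp
  define G where "G = {{\<omega>\<in>space M. \<forall>j\<in>J. X j \<omega> \<in> B j} | J B.
      finite J \<and> J \<subseteq> {0..s} \<and> (\<forall>j\<in>J. B j \<in> sets (borel :: real measure))}"
  define H where "H = {D -` C \<inter> space M | C. C \<in> sets borel}"
  \<comment> \<open>\<open>X'\<close> is 0 for the cylinders in \<open>G\<close> and
    \<open>X 0\<close> for their version with increments.\<close>
  have cyl: "{\<omega>\<in>space M. \<forall>j\<in>J. X j \<omega> - X' \<omega> \<in> B j} \<in> events"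
    if "finite J" "J \<subseteq> {0..s}" "\<forall>j\<in>J. B j \<in> sets borel" "X' \<in> borel_measurable M" for J B X'
  proof (rule sets.sets_Collect_finite_All)
    fix j assume "j \<in> J"
    then have "(\<lambda>\<omega>. X j \<omega> - X' \<omega>) -` B j \<inter> space M \<in> events"
      using that meas[of j] by (intro measurable_sets[where A = borel] borel_measurable_diff) auto
    then show "{\<omega>\<in>space M. X j \<omega> - X' \<omega> \<in> B j} \<in> events"
      by (simp add: vimage_def Int_def conj_commute)
  qed (use that in auto)
  have GH: "indep_set G H"
  proof (rule indep_setI)
    show "G \<subseteq> events" using cyl[of _ _ "\<lambda>_. 0"] by (auto simp: G_def)
    show "H \<subseteq> events" by (auto simp: H_def)
    fix a b assume "a \<in> G" "b \<in> H"
    then obtain J B C where J: "finite J" "J \<subseteq> {0..s}" "\<forall>j\<in>J. B j \<in> sets borel"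
      and a: "a = {\<omega>\<in>space M. \<forall>j\<in>J. X j \<omega> \<in> B j}"
      and C: "C \<in> sets borel" and b: "b = D -` C \<inter> space M"
      by (auto simp: G_def H_def)
    let ?a = "{\<omega>\<in>space M. \<forall>j\<in>J. X j \<omega> - X 0 \<omega> \<in> B j}"
    have b': "b = {\<omega>\<in>space M. X t \<omega> - X s \<omega> \<in> C}" by (auto simp: b D_def)
    have ev: "a \<in> events" "?a \<in> events" "b \<in> events"
      using cyl[OF J, of "\<lambda>_. 0"] cyl[OF J, of "X 0"] meas[of 0] C by (auto simp: a b)
    \<comment> \<open>\<open>X 0\<close> vanishes only almost surely, so cylinders of values and of
      increments from time 0 agree up to a null set; their probabilities coincide.\<close>
    have ae: "AE \<omega> in M. \<omega> \<in> a \<longleftrightarrow> \<omega> \<in> ?a"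
      using X0 by eventually_elim (auto simp: a)
    have "prob (a \<inter> b) = prob (?a \<inter> b)"
      using ae ev by (intro finite_measure_eq_AE) auto
    also have "\<dots> = prob ?a * prob b"
      unfolding b' using J C by (intro indep_cylinder_increment indep_incr st) auto
    also have "prob ?a = prob a"
      using ae ev by (intro finite_measure_eq_AE) auto
    finally show "prob (a \<inter> b) = prob a * prob b" .
  qed
  have "Int_stable G"
  proof (rule Int_stableI)
    fix a b assume "a \<in> G" "b \<in> G"
    then obtain J B J' B' where J: "finite J" "J \<subseteq> {0..s}" "\<forall>j\<in>J. B j \<in> sets borel"
      "finite J'" "J' \<subseteq> {0..s}" "\<forall>j\<in>J'. B' j \<in> sets borel"
      and ab: "a = {\<omega>\<in>space M. \<forall>j\<in>J. X j \<omega> \<in> B j}" "b = {\<omega>\<in>space M. \<forall>j\<in>J'. X j \<omega> \<in> B' j}"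
      by (auto simp: G_def)
    \<comment> \<open>A time in only one of the index sets gets the trivial constraint
      \<open>UNIV\<close> from the other.\<close>
    let ?B = "\<lambda>j. (if j \<in> J then B j else UNIV) \<inter> (if j \<in> J' then B' j else UNIV)"
    have "a \<inter> b = {\<omega>\<in>space M. \<forall>j\<in>J \<union> J'. X j \<omega> \<in> ?B j}"
      unfolding ab by auto
    moreover have "\<forall>j\<in>J \<union> J'. ?B j \<in> sets borel" using J by auto
    ultimately show "a \<inter> b \<in> G"
      unfolding G_def using J by (intro CollectI exI[of _ "J \<union> J'"] exI[of _ ?B]) auto
  qed
  moreover have "Int_stable H"
  proof (rule Int_stableI)
    fix a b assume "a \<in> H" "b \<in> H"
    then obtain C C' where "C \<in> sets borel" "C' \<in> sets borel" "a = D -` C \<inter> space M" "b = D -` C' \<inter> space M"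
      by (auto simp: H_def)
    then show "a \<inter> b \<in> H"
      unfolding H_def by (intro CollectI exI[of _ "C \<inter> C'"]) auto
  qed
  ultimately have ind: "indep_set (sigma_sets (space M) G) (sigma_sets (space M) H)"
    by (rule indep_set_sigma_sets[OF GH])
  have "X r -` A \<inter> space M \<in> G" if "r \<in> {0..s}" "A \<in> sets borel" for r A
    unfolding G_def using that by (intro CollectI exI[of _ "{r}"] exI[of _ "\<lambda>_. A"]) auto
  then have sub: "sets (natural_filtration M X s) \<subseteq> sigma_sets (space M) G"
    unfolding sets_natural_filtration by (intro sigma_sets_mono) (auto intro: sigma_sets.Basic)
  have Z_sub: "sigma_sets (space M) {Z -` A \<inter> space M | A. A \<in> sets borel} \<subseteq> sigma_sets (space M) G"
    using measurable_sets[OF Z] sub by (intro sigma_sets_mono) auto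
  have Z_rv: "random_variable borel Z"
    using measurable_sets[OF Z] sets_natural_filtration_subset[of s X M] meas
    by (intro measurableI) auto
  have "indep_set (sigma_sets (space M) {Z -` A \<inter> space M | A. A \<in> sets borel}) (sigma_sets (space M) H)"
    using ind Z_sub unfolding indep_set_def
    by (rule_tac indep_sets_mono_sets) (auto split: bool.splits)
  then show ?thesis
    unfolding indep_var_eq using Z_rv D_meas by (simp add: H_def D_def[abs_def])
qed

text \<open>Coefficient form of \<open>E[1_A e^(u X_t)] = E[1_A e^(u X_s)] E[e^(u D)]\<close> with
  \<open>D = X_t - X_s\<close>: the binomial theorem splits the powers, and independence of the past
  splits the expectations.\<close>

lemma (in prob_space) truncated_moments_increment:
  fixes X :: "real \<Rightarrow> 'a \<Rightarrow> real"
  assumes meas: "\<And>t. t \<ge> 0 \<Longrightarrow> X t \<in> borel_measurable M"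
    and X0: "AE \<omega> in M. X 0 \<omega> = 0"
    and indep_incr: "\<And>ts. sorted_wrt (<) ts \<Longrightarrow> (\<forall>t\<in>set ts. t \<ge> 0) \<Longrightarrow>
          indep_vars (\<lambda>_. borel) (\<lambda>i \<omega>. X (ts ! Suc i) \<omega> - X (ts ! i) \<omega>) {..<length ts - 1}"
    and moments: "\<And>t k. t \<ge> 0 \<Longrightarrow> integrable M (\<lambda>\<omega>. X t \<omega> ^ k)"
    and st: "0 \<le> s" "s < t"
    and A: "A \<in> sets (natural_filtration M X s)"
  shows "Abs_fps (\<lambda>n. LINT \<omega>:A|M. X t \<omega> ^ n / fact n)
       = Abs_fps (\<lambda>n. LINT \<omega>:A|M. X s \<omega> ^ n / fact n)
         * Abs_fps (\<lambda>n. expectation (\<lambda>\<omega>. (X t \<omega> - X s \<omega>) ^ n / fact n))"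
proof (rule fps_ext)
  fix n
  define D where "D \<omega> = X t \<omega> - X s \<omega>" for \<omega>
  note X_meas[measurable] = meas[OF st(1)] meas[of t, OF order.trans[OF st(1) less_imp_le[OF st(2)]]]
  have D_meas[measurable]: "D \<in> borel_measurable M" unfolding D_def[abs_def] by measurable
  have A_ev[measurable]: "A \<in> events"
    using A sets_natural_filtration_subset[of s X M] meas by auto
  \<comment> \<open>The indicator goes into the factor measurable with respect to the past at time
    \<open>s\<close>.\<close>
  let ?Z = "\<lambda>i \<omega>. indicator A \<omega> * (X s \<omega> ^ i / fact i) :: real"
  let ?W = "\<lambda>i \<omega>. D \<omega> ^ i / fact i"
  have int_Z: "integrable M (?Z i)" for i
    using integrable_real_mult_indicator[OF A_ev integrable_divide[OF moments[OF st(1)]], of i "fact i"]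
    by (simp add: mult.commute)
  have int_W: "integrable M (?W i)" for i
  proof (rule Bochner_Integration.integrable_bound)
    show "integrable M (\<lambda>\<omega>. 2 ^ i * (\<bar>X t \<omega> ^ i\<bar> + \<bar>X s \<omega> ^ i\<bar>))"
      using moments[of t i] moments[of s i] st
      by (intro integrable_mult_right Bochner_Integration.integrable_add integrable_abs) auto
    have "norm (?W i \<omega>) \<le> norm (2 ^ i * (\<bar>X t \<omega> ^ i\<bar> + \<bar>X s \<omega> ^ i\<bar>))" for \<omega>
    proof -
      have "norm (?W i \<omega>) \<le> \<bar>D \<omega>\<bar> ^ i"
        by (simp add: power_abs divide_le_eq mult_le_cancel_left1 fact_ge_1)
      also have "\<dots> \<le> (2 * max \<bar>X t \<omega>\<bar> \<bar>X s \<omega>\<bar>) ^ i"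
        unfolding D_def by (intro power_mono) auto
      also have "\<dots> = 2 ^ i * max \<bar>X t \<omega>\<bar> \<bar>X s \<omega>\<bar> ^ i"
        by (simp add: power_mult_distrib)
      also have "\<dots> \<le> 2 ^ i * (\<bar>X t \<omega>\<bar> ^ i + \<bar>X s \<omega>\<bar> ^ i)"
        by (intro mult_left_mono) (auto simp: max_def)
      finally show ?thesis by (simp add: power_abs)
    qed
    then show "AE \<omega> in M. norm (?W i \<omega>) \<le> norm (2 ^ i * (\<bar>X t \<omega> ^ i\<bar> + \<bar>X s \<omega> ^ i\<bar>))"
      by simp
  qed measurable
  have ZW: "indep_var borel (?Z i) borel (?W j)" for i j
  proof -
    note [measurable] = A measurable_natural_filtration[of s s X M, OF st(1) order.refl]
    have "?Z i \<in> borel_measurable (natural_filtration M X s)" by measurable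
    from indep_natural_filtration_increment[OF meas X0 indep_incr st this]
    have "indep_var borel (?Z i) borel D" by (simp add: D_def[abs_def])
    from indep_var_compose[OF this, of "\<lambda>x. x" borel "\<lambda>x. x ^ j / fact j" borel]
    show ?thesis by (simp add: comp_def)
  qed
  have "indicator A \<omega> * (X t \<omega> ^ n / fact n) = (\<Sum>i=0..n. ?Z i \<omega> * ?W (n - i) \<omega>)" for \<omega>
  proof -
    \<comment> \<open>The binomial theorem with factorials, read off from the product rule for
      \<open>fps_exp\<close>.\<close>
    have "X t \<omega> ^ n / fact n = fps_nth (fps_exp (X s \<omega> + D \<omega>)) n" by (simp add: D_def)
    also have "\<dots> = (\<Sum>i=0..n. (X s \<omega> ^ i / fact i) * ?W (n - i) \<omega>)"
      unfolding fps_exp_add_mult fps_mult_nth by simp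
    finally show ?thesis by (simp add: sum_distrib_left mult.assoc)
  qed
  then have "(LINT \<omega>:A|M. X t \<omega> ^ n / fact n) = (\<Sum>i=0..n. expectation (\<lambda>\<omega>. ?Z i \<omega> * ?W (n - i) \<omega>))"
    unfolding set_lebesgue_integral_def real_scaleR_def
    using indep_var_integrable[OF ZW int_Z int_W]
    by (simp only: Bochner_Integration.integral_sum)
  also have "\<dots> = (\<Sum>i=0..n. expectation (?Z i) * expectation (?W (n - i)))"
    by (simp only: indep_var_lebesgue_integral[OF ZW int_Z int_W])
  finally show "fps_nth (Abs_fps (\<lambda>n. LINT \<omega>:A|M. X t \<omega> ^ n / fact n)) n =
      fps_nth (Abs_fps (\<lambda>n. LINT \<omega>:A|M. X s \<omega> ^ n / fact n)
         * Abs_fps (\<lambda>n. expectation (\<lambda>\<omega>. (X t \<omega> - X s \<omega>) ^ n / fact n))) n"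
    by (simp only: fps_mult_nth fps_nth_Abs_fps set_lebesgue_integral_def real_scaleR_def D_def)
qed

section \<open>The martingale property\<close>

theorem theorem1:
  fixes M :: "'a measure" and X :: "real \<Rightarrow> 'a \<Rightarrow> real"
    and \<sigma>2 :: "real \<Rightarrow> real" and \<nu> :: "real \<Rightarrow> real measure"
    and F :: "nat \<Rightarrow> real \<Rightarrow> real" and n :: nat
  assumes P: "prob_space M"
    and meas: "\<And>t. t \<ge> 0 \<Longrightarrow> X t \<in> borel_measurable M"
    and X0: "AE \<omega> in M. X 0 \<omega> = 0"
    and indep_incr: "\<And>ts. sorted_wrt (<) ts \<Longrightarrow> (\<forall>t\<in>set ts. t \<ge> 0) \<Longrightarrow>
          prob_space.indep_vars M (\<lambda>_. borel)
            (\<lambda>i \<omega>. X (ts ! Suc i) \<omega> - X (ts ! i) \<omega>) {..<length ts - 1}"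
    and cont_prob: "\<And>t e. t \<ge> 0 \<Longrightarrow> e > 0 \<Longrightarrow>
          ((\<lambda>s. measure M {\<omega>\<in>space M. \<bar>X s \<omega> - X t \<omega>\<bar> > e}) \<longlongrightarrow> 0) (at t within {0..})"
    and cadlag: "AE \<omega> in M. \<forall>t\<ge>0. continuous (at_right t) (\<lambda>s. X s \<omega>) \<and>
                   (t > 0 \<longrightarrow> (\<exists>l. ((\<lambda>s. X s \<omega>) \<longlongrightarrow> l) (at_left t)))"
    and mean0: "\<And>t. t \<ge> 0 \<Longrightarrow> integral\<^sup>L M (X t) = 0"
    and moments: "\<And>t k. t \<ge> 0 \<Longrightarrow> k \<ge> 1 \<Longrightarrow> integrable M (\<lambda>\<omega>. \<bar>X t \<omega>\<bar> ^ k)"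
    and LK: "\<And>t. t \<ge> 0 \<Longrightarrow> levy_khintchine (distr M borel (X t)) (\<sigma>2 t) (\<nu> t)"
    and F2: "\<And>t. F 2 t = \<sigma>2 t + (LINT x:(UNIV - {0})|\<nu> t. x ^ 2)"
    and Fk: "\<And>k t. k \<ge> 3 \<Longrightarrow> F k t = (LINT x:(UNIV - {0})|\<nu> t. x ^ k)"
    and n: "n \<ge> 1"
  shows "martingale_wrt M (natural_filtration M X)
           (\<lambda>t \<omega>. kendall n (\<lambda>k. if k = 1 then X t \<omega> else - F k t))"
proof -
  interpret prob_space M by (rule P)
  have mom: "integrable M (\<lambda>\<omega>. X t \<omega> ^ k)" if "t \<ge> 0" for t k
  proof (cases "k = 0")
    case False
    have "integrable M (\<lambda>\<omega>. norm (X t \<omega> ^ k))"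
      using moments[of t k] that False by (simp add: power_abs)
    then show ?thesis
      by (rule integrable_norm_cancel) (use meas[OF that] in measurable)
  qed simp
  \<comment> \<open>\<open>K t\<close> is the cumulant series, \<open>N t\<close> will be the
    reciprocal of the moment series, and \<open>m A t\<close> is the moment series restricted to the
    event \<open>A\<close>.\<close>
  define K where "K t = Abs_fps (\<lambda>k. if k < 2 then 0 else F k t / fact k)" for t
  define N where "N t = fps_exp 1 oo - K t" for t
  define m where "m A t = Abs_fps (\<lambda>n. LINT \<omega>:A|M. X t \<omega> ^ n / fact n)" for A t
  \<comment> \<open>For \<open>k \<ge> 2\<close> the integrand vanishes at 0, so the integral over
    all reals is the same.\<close>
  have F: "F k t = (if k = 2 then \<sigma>2 t else 0) + (LINT x|\<nu> t. x ^ k)" if "k \<ge> 2" for k t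
  proof -
    have "indicator (UNIV - {0}) x *\<^sub>R x ^ k = x ^ k" for x :: real
      using that by (cases "x = 0") auto
    then have "(LINT x:(UNIV - {0})|\<nu> t. x ^ k) = (LINT x|\<nu> t. x ^ k)"
      by (simp only: set_lebesgue_integral_def)
    then show ?thesis
      using F2[of t] Fk[of k t] that by (cases "k = 2") auto
  qed
  have m_space: "m (space M) t = fps_exp 1 oo K t" if "t \<ge> 0" for t
  proof -
    have "m (space M) t = Abs_fps (\<lambda>n. expectation (\<lambda>\<omega>. X t \<omega> ^ n) / fact n)"
      unfolding m_def using mom[OF that] by (simp add: set_integral_space)
    also have "\<dots> = fps_exp 1 oo Abs_fps (\<lambda>k. if k < 2 then 0 else
        ((if k = 2 then \<sigma>2 t else 0) + (LINT x|\<nu> t. x ^ k)) / fact k)"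
      by (rule moment_fps_eq_exp_cumulant_fps[OF meas[OF that] mom[OF that] mean0[OF that] LK[OF that]])
    also have "Abs_fps (\<lambda>k. if k < 2 then 0 else ((if k = 2 then \<sigma>2 t else 0) + (LINT x|\<nu> t. x ^ k)) / fact k) = K t"
      unfolding K_def by (rule arg_cong[where f = Abs_fps]) (auto simp: F)
    finally show ?thesis .
  qed
  have N: "m (space M) t * N t = 1" if "t \<ge> 0" for t
  proof -
    have "m (space M) t * N t = fps_exp 1 oo (K t + - K t)"
      unfolding m_space[OF that] N_def by (rule fps_exp_compose_add[symmetric]) (simp_all add: K_def)
    then show ?thesis by simp
  qed
  have kendall: "kendall n (\<lambda>k. if k = 1 then X t \<omega> else - F k t)
      = fact n * (\<Sum>i=0..n. X t \<omega> ^ i / fact i * fps_nth (N t) (n - i))" for t \<omega>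
    unfolding kendall_shift[of n "X t \<omega>" "\<lambda>k. F k t"] fps_mult_nth by (simp add: N_def K_def)
  \<comment> \<open>For fixed \<open>t\<close> the integrand is a polynomial in \<open>X t\<close>,
    so integration over \<open>A\<close> replaces the powers by truncated moments and leaves a
    Cauchy product coefficient.\<close>
  have lint_kendall: "(LINT \<omega>:A|M. kendall n (\<lambda>k. if k = 1 then X t \<omega> else - F k t)) = fact n * fps_nth (m A t * N t) n"
    if "t \<ge> 0" "A \<in> events" for A t
  proof -
    have int: "set_integrable M A (\<lambda>\<omega>. X t \<omega> ^ i / fact i * fps_nth (N t) (n - i))" for i
      unfolding set_integrable_def
      using that mom[of t i] by (intro integrable_mult_indicator integrable_mult_left integrable_divide) auto
    have "(LINT \<omega>:A|M. kendall n (\<lambda>k. if k = 1 then X t \<omega> else - F k t))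
        = fact n * (LINT \<omega>:A|M. (\<Sum>i=0..n. X t \<omega> ^ i / fact i * fps_nth (N t) (n - i)))"
      unfolding kendall by (rule set_integral_mult_right)
    also have "(LINT \<omega>:A|M. (\<Sum>i=0..n. X t \<omega> ^ i / fact i * fps_nth (N t) (n - i)))
        = (\<Sum>i=0..n. LINT \<omega>:A|M. X t \<omega> ^ i / fact i * fps_nth (N t) (n - i))"
      using int unfolding set_lebesgue_integral_def set_integrable_def scaleR_sum_right
      by (rule Bochner_Integration.integral_sum)
    also have "\<dots> = fps_nth (m A t * N t) n"
      unfolding fps_mult_nth m_def fps_nth_Abs_fps set_integral_mult_left ..
    finally show ?thesis .
  qed
  have "integrable M (\<lambda>\<omega>. kendall n (\<lambda>k. if k = 1 then X t \<omega> else - F k t))" if "t \<ge> 0" for t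
    unfolding kendall
    by (intro integrable_mult_right integrable_mult_left integrable_divide Bochner_Integration.integrable_sum mom that)
  moreover have "(\<lambda>\<omega>. kendall n (\<lambda>k. if k = 1 then X t \<omega> else - F k t)) \<in> borel_measurable (natural_filtration M X t)"
    if "t \<ge> 0" for t
  proof -
    note [measurable] = measurable_natural_filtration[of t t X M, OF that order.refl]
    show ?thesis unfolding kendall by measurable
  qed
  moreover have "(LINT \<omega>:A|M. kendall n (\<lambda>k. if k = 1 then X t \<omega> else - F k t))
      = (LINT \<omega>:A|M. kendall n (\<lambda>k. if k = 1 then X s \<omega> else - F k s))"
    if s: "0 \<le> s" and st: "s \<le> t" and A: "A \<in> sets (natural_filtration M X s)" for s t A
  proof (cases "s = t")
    case True
    then show ?thesis by (simp only:)
  next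
    case False
    then have st': "s < t" using st by simp
    have t: "0 \<le> t" using s st by simp
    have A_ev: "A \<in> events"
      using A sets_natural_filtration_subset[of s X M] meas by auto
    define d where "d = Abs_fps (\<lambda>n. expectation (\<lambda>\<omega>. (X t \<omega> - X s \<omega>) ^ n / fact n))"
    have d: "m B t = m B s * d" if "B \<in> sets (natural_filtration M X s)" for B
      unfolding m_def d_def
      by (rule truncated_moments_increment[OF meas X0 indep_incr mom s st' that])
    \<comment> \<open>On the whole space the factorisation gives
      \<open>m_s d N_t = 1 = m_s N_s\<close>, hence \<open>d N_t = N_s\<close>; so \<open>d\<close>
      cancels over \<open>A\<close> as well.\<close>
    have "space M \<in> sets (natural_filtration M X s)"
      using sets.top[of "natural_filtration M X s"] by simp
    then have "m (space M) s * (d * N t) = 1"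
      using N[OF t] d[of "space M"] by (simp add: mult.assoc)
    then have "N s = N s * (m (space M) s * (d * N t))" by simp
    also have "\<dots> = (m (space M) s * N s) * (d * N t)" by (simp only: mult_ac)
    also have "\<dots> = d * N t" using N[OF s] by simp
    finally have "d * N t = N s" ..
    then have "m A t * N t = m A s * N s"
      unfolding d[OF A] by (simp add: mult.assoc)
    then show ?thesis
      unfolding lint_kendall[OF s A_ev] lint_kendall[OF t A_ev] by simp
  qed
  ultimately show ?thesis
    unfolding martingale_wrt_def by blast
qed

end
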